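(* Let $\mu$ be a probability measure on $\mathbb{R}$ and $\beta>0$ a real number such that, for a random variable $X_1$ with law $\mu$: (1) $E X_1<0$; (2) $E e^{\beta X_1}=1$; (3) $\mu$ has compact support. For each integer $m\ge 1$, let $\mu^{(m)}$ be the probability measure defined from $\mu$ and $\beta$ as in the context, let $X^{(m)}_1,X^{(m)}_2,\dots$ be i.i.d. random variables with law $\mu^{(m)}$, and let $S^{(m)}_0=0$, $S^{(m)}_n=\sum_{i=1}^n X^{(m)}_i$ for $n\ge 1$. Let $\sigma$ be given by the formula for $\sigma^2$ in the context. Then, as $m\to\infty$, $$\left\{\frac{1}{\sqrt m}\,S^{(m)}_{[mt]},\ t\ge 0\right\}\longrightarrow\left\{H(t)=\sigma\cdot B(t)-\frac{\beta}{2}\,t,\ t\ge 0\right\}$$ in distribution in $\mathcal{D}[0,+\infty)$, where $(B(t),t\ge 0)$ is a standard Brownian motion.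
   Context: Here $[x]$ denotes the integer part of $x$, and $\mathcal{D}[0,+\infty)$ is the space of real-valued càdlàg functions on $[0,\infty)$ with the Skorokhod topology. Put $c:=\int_0^\infty (e^{\beta x}-1)\,\mu(dx)=\int_{-\infty}^0 -(e^{\beta x}-1)\,\mu(dx)>0$. For each integer $m\ge1$, $\mu^{(m)}$ is defined by requiring, for every bounded continuous function $\varphi$, $$\int_{\mathbb{R}}\varphi(x)\,\mu^{(m)}(dx)=c^{-1}\int_0^\infty\mu(dv)\int_{-\infty}^0\mu(du)\,(e^{\beta v}-e^{\beta u})\left[\left(\frac{-v}{u-v}-\frac{\beta}{2\sqrt m\,(u-v)}\right)\varphi(u)+\left(\frac{u}{u-v}+\frac{\beta}{2\sqrt m\,(u-v)}\right)\varphi(v)\right].$$ It is asserted, as part of the construction, that $\mu^{(m)}$ is a probability measure for each $m\ge 1$. Also $$\sigma^2:=-c^{-1}\int_0^\infty\mu(dv)\int_{-\infty}^0\mu(du)\,(e^{\beta v}-e^{\beta u})\,uv,$$ and $0<\sigma^2<\infty$. *)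

theory Defs
  imports "HOL-Probability.Probability"
begin

section \<open>The approximating measures and the variance\<close>

definition measure_support :: "'a::topological_space measure \<Rightarrow> 'a set" where
  "measure_support M = {x. \<forall>U. open U \<and> x \<in> U \<longrightarrow> emeasure M U > 0}"

text \<open>
  In the iterated integrals below, the integral from \<open>0\<close> to \<open>\<infinity>\<close> runs over \<open>{0..}\<close> and the
  one from \<open>-\<infinity>\<close> to \<open>0\<close> over \<open>{..<0}\<close>.  The placement of the point \<open>0\<close> matters only for
  the measures specified by \<open>is_mu_m\<close>, and only if \<open>\<mu>\<close> charges \<open>0\<close>: their total mass is
  always \<open>1\<close> if exactly one of the two half-lines contains \<open>0\<close>, but it is \<open>1 - \<mu>{0}\<close> if neither
  does and \<open>1 + \<mu>{0}\<close> if both do.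
\<close>

definition tilt_const :: "real measure \<Rightarrow> real \<Rightarrow> real" where
  "tilt_const \<mu> \<beta> = (LINT x:{0..}|\<mu>. exp (\<beta> * x) - 1)"

definition is_mu_m :: "real measure \<Rightarrow> real \<Rightarrow> nat \<Rightarrow> real measure \<Rightarrow> bool" where
  "is_mu_m \<mu> \<beta> m N \<longleftrightarrow>
     real_distribution N \<and>
     (\<forall>\<phi>::real \<Rightarrow> real. continuous_on UNIV \<phi> \<and> bounded (range \<phi>) \<longrightarrow>
        (LINT x|N. \<phi> x) =
          inverse (tilt_const \<mu> \<beta>) *
          (LINT v:{0..}|\<mu>. LINT u:{..<0}|\<mu>.
             (exp (\<beta> * v) - exp (\<beta> * u)) *
             ((- v / (u - v) - \<beta> / (2 * sqrt (real m) * (u - v))) * \<phi> u +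
              (u / (u - v) + \<beta> / (2 * sqrt (real m) * (u - v))) * \<phi> v)))"

definition sigma2 :: "real measure \<Rightarrow> real \<Rightarrow> real" where
  "sigma2 \<mu> \<beta> =
     - inverse (tilt_const \<mu> \<beta>) *
     (LINT v:{0..}|\<mu>. LINT u:{..<0}|\<mu>. (exp (\<beta> * v) - exp (\<beta> * u)) * (u * v))"

section \<open>The Skorokhod space \<open>D[0,\<infinity>)\<close>\<close>

text \<open>Functions on \<open>[0,\<infinity>)\<close> are represented as functions on \<open>real\<close> that are
  \<open>undefined\<close> at negative arguments.\<close>

definition cadlag :: "(real \<Rightarrow> real) set" where
  "cadlag = {x \<in> extensional {0..}.
     (\<forall>t\<ge>0. (x \<longlongrightarrow> x t) (at_right t)) \<and> (\<forall>t>0. \<exists>l. (x \<longlongrightarrow> l) (at_left t))}"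

text \<open>A strictly increasing map of \<open>[0,\<infinity>)\<close> onto itself is an increasing homeomorphism.\<close>

definition time_changes :: "(real \<Rightarrow> real) set" where
  "time_changes = {\<tau>. strict_mono_on {0..} \<tau> \<and> \<tau> ` {0..} = {0..}}"

text \<open>
  The (J1) topology is the one in which \<open>y_n\<close> converges to \<open>x\<close> iff there are time changes
  \<open>\<tau>_n\<close> such that \<open>\<bar>\<tau>_n s - s\<bar> \<rightarrow> 0\<close> uniformly in \<open>s \<ge> 0\<close> and \<open>\<bar>y_n (\<tau>_n s) - x s\<bar> \<rightarrow> 0\<close>
  uniformly in \<open>s \<in> [0,T]\<close> for every \<open>T\<close> (Jacod and Shiryaev, Limit Theorems for Stochastic
  Processes, Theorem VI.1.14).  The sets \<open>skorokhod_nhd x T \<epsilon>\<close> below are a neighbourhood base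
  at \<open>x\<close> for it; the bound \<open>\<delta> < \<epsilon>\<close> expresses that both suprema are strictly below \<open>\<epsilon>\<close>, which
  makes these sets open.
\<close>

definition skorokhod_nhd :: "(real \<Rightarrow> real) \<Rightarrow> real \<Rightarrow> real \<Rightarrow> (real \<Rightarrow> real) set" where
  "skorokhod_nhd x T \<epsilon> = {y \<in> cadlag. \<exists>\<tau>\<in>time_changes. \<exists>\<delta><\<epsilon>.
     (\<forall>s\<ge>0. \<bar>\<tau> s - s\<bar> \<le> \<delta>) \<and> (\<forall>s\<in>{0..T}. \<bar>y (\<tau> s) - x s\<bar> \<le> \<delta>)}"

definition skorokhod :: "(real \<Rightarrow> real) topology" where
  "skorokhod = topology (\<lambda>U. U \<subseteq> cadlag \<and>
     (\<forall>x\<in>U. \<exists>T\<ge>0. \<exists>\<epsilon>>0. skorokhod_nhd x T \<epsilon> \<subseteq> U))"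

lemma skorokhod_nhd_mono:
  "T \<le> T' \<Longrightarrow> \<epsilon>' \<le> \<epsilon> \<Longrightarrow> skorokhod_nhd x T' \<epsilon>' \<subseteq> skorokhod_nhd x T \<epsilon>"
proof
  fix y assume "T \<le> T'" and e: "\<epsilon>' \<le> \<epsilon>" and "y \<in> skorokhod_nhd x T' \<epsilon>'"
  then obtain l d where "y \<in> cadlag" "l \<in> time_changes" "d < \<epsilon>'" "\<forall>s\<ge>0. \<bar>l s - s\<bar> \<le> d"
    "\<forall>s\<in>{0..T}. \<bar>y (l s) - x s\<bar> \<le> d"
    unfolding skorokhod_nhd_def by auto
  moreover have "d < \<epsilon>" using \<open>d < \<epsilon>'\<close> e by simp
  ultimately show "y \<in> skorokhod_nhd x T \<epsilon>" unfolding skorokhod_nhd_def by blast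
qed

lemma openin_skorokhod:
  "openin skorokhod U \<longleftrightarrow> U \<subseteq> cadlag \<and> (\<forall>x\<in>U. \<exists>T\<ge>0. \<exists>\<epsilon>>0. skorokhod_nhd x T \<epsilon> \<subseteq> U)"
proof -
  have "istopology (\<lambda>U. U \<subseteq> cadlag \<and> (\<forall>x\<in>U. \<exists>T\<ge>0. \<exists>\<epsilon>>0. skorokhod_nhd x T \<epsilon> \<subseteq> U))"
    unfolding istopology_def
  proof (intro conjI allI impI; (elim conjE)?)
    fix S U assume S: "\<forall>x\<in>S. \<exists>T\<ge>0. \<exists>\<epsilon>>0. skorokhod_nhd x T \<epsilon> \<subseteq> S"
      and U: "\<forall>x\<in>U. \<exists>T\<ge>0. \<exists>\<epsilon>>0. skorokhod_nhd x T \<epsilon> \<subseteq> U"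
    show "\<forall>x\<in>S \<inter> U. \<exists>T\<ge>0. \<exists>\<epsilon>>0. skorokhod_nhd x T \<epsilon> \<subseteq> S \<inter> U"
    proof
      fix x assume "x \<in> S \<inter> U"
      with S U obtain T \<epsilon> T' \<epsilon>' where *: "T \<ge> 0" "\<epsilon> > 0" "skorokhod_nhd x T \<epsilon> \<subseteq> S"
        "T' \<ge> 0" "\<epsilon>' > 0" "skorokhod_nhd x T' \<epsilon>' \<subseteq> U" by (meson IntD1 IntD2)
      have "skorokhod_nhd x (max T T') (min \<epsilon> \<epsilon>') \<subseteq> S \<inter> U"
        using skorokhod_nhd_mono[of T "max T T'" "min \<epsilon> \<epsilon>'" \<epsilon> x]
          skorokhod_nhd_mono[of T' "max T T'" "min \<epsilon> \<epsilon>'" \<epsilon>' x] * by auto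
      then show "\<exists>T\<ge>0. \<exists>\<epsilon>>0. skorokhod_nhd x T \<epsilon> \<subseteq> S \<inter> U"
        using * by (intro exI[of _ "max T T'"] exI[of _ "min \<epsilon> \<epsilon>'"] conjI) auto
    qed
  next
    fix \<K> assume K: "\<forall>K\<in>\<K>. K \<subseteq> cadlag \<and> (\<forall>x\<in>K. \<exists>T\<ge>0. \<exists>\<epsilon>>0. skorokhod_nhd x T \<epsilon> \<subseteq> K)"
    show "\<forall>x\<in>\<Union>\<K>. \<exists>T\<ge>0. \<exists>\<epsilon>>0. skorokhod_nhd x T \<epsilon> \<subseteq> \<Union>\<K>"
    proof
      fix x assume "x \<in> \<Union>\<K>"
      then obtain K where K': "K \<in> \<K>" "x \<in> K" by blast
      with K obtain T \<epsilon> where "T \<ge> 0" "\<epsilon> > 0" "skorokhod_nhd x T \<epsilon> \<subseteq> K" by meson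
      with K' show "\<exists>T\<ge>0. \<exists>\<epsilon>>0. skorokhod_nhd x T \<epsilon> \<subseteq> \<Union>\<K>" by (meson Union_upper order_trans)
    qed
  qed auto
  then show ?thesis
    unfolding skorokhod_def by (simp add: topology_inverse')
qed

lemma topspace_skorokhod: "topspace skorokhod = cadlag"
proof
  have "openin skorokhod cadlag"
    unfolding openin_skorokhod
    by (auto intro!: exI[of _ 0] exI[of _ 1] simp: skorokhod_nhd_def)
  then show "cadlag \<subseteq> topspace skorokhod" by (rule openin_subset)
  show "topspace skorokhod \<subseteq> cadlag" using openin_skorokhod openin_topspace by blast
qed

lemma openin_skorokhod_nhd:
  assumes "T \<ge> 0"
  shows "openin skorokhod (skorokhod_nhd x T \<epsilon>)"
  unfolding openin_skorokhod
proof (intro conjI ballI)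
  show "skorokhod_nhd x T \<epsilon> \<subseteq> cadlag" by (auto simp: skorokhod_nhd_def)
  fix y assume "y \<in> skorokhod_nhd x T \<epsilon>"
  then obtain l d where l: "l \<in> time_changes" and d: "d < \<epsilon>"
    and 1: "\<And>s. s \<ge> 0 \<Longrightarrow> \<bar>l s - s\<bar> \<le> d" and 2: "\<And>s. s \<in> {0..T} \<Longrightarrow> \<bar>y (l s) - x s\<bar> \<le> d"
    unfolding skorokhod_nhd_def by blast
  have l_ge: "l s \<ge> 0" if "s \<ge> 0" for s using l that unfolding time_changes_def by auto
  have l_mono: "l s \<le> l t" if "0 \<le> s" "s \<le> t" for s t
    using l that unfolding time_changes_def
    by (cases "s = t") (auto dest!: strict_mono_onD[of _ _ s t])
  have "skorokhod_nhd y (l T) (\<epsilon> - d) \<subseteq> skorokhod_nhd x T \<epsilon>"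
  proof
    fix z assume "z \<in> skorokhod_nhd y (l T) (\<epsilon> - d)"
    then obtain k e where z: "z \<in> cadlag" and k: "k \<in> time_changes" and e: "e < \<epsilon> - d"
      and 3: "\<And>s. s \<ge> 0 \<Longrightarrow> \<bar>k s - s\<bar> \<le> e" and 4: "\<And>s. s \<in> {0..l T} \<Longrightarrow> \<bar>z (k s) - y s\<bar> \<le> e"
      unfolding skorokhod_nhd_def by blast
    have "k \<circ> l \<in> time_changes"
      unfolding time_changes_def
    proof (intro CollectI conjI)
      show "strict_mono_on {0..} (k \<circ> l)"
        using k l l_ge unfolding time_changes_def strict_mono_on_def by auto
      show "(k \<circ> l) ` {0..} = {0..}"
        using k l unfolding time_changes_def by (simp only: image_comp[symmetric] mem_Collect_eq)
    qed
    moreover have "\<bar>(k \<circ> l) s - s\<bar> \<le> d + e" if "s \<ge> 0" for s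
      using 1[OF that] 3[OF l_ge[OF that]] by simp
    moreover have "\<bar>z ((k \<circ> l) s) - x s\<bar> \<le> d + e" if "s \<in> {0..T}" for s
      using 2[OF that] 4[of "l s"] l_ge[of s] l_mono[of s T] that by simp
    moreover have "d + e < \<epsilon>" using e by simp
    ultimately show "z \<in> skorokhod_nhd x T \<epsilon>" using z unfolding skorokhod_nhd_def by blast
  qed
  then show "\<exists>T'\<ge>0. \<exists>\<epsilon>'>0. skorokhod_nhd y T' \<epsilon>' \<subseteq> skorokhod_nhd x T \<epsilon>"
    using l_ge[OF assms] d by (intro exI[of _ "l T"] conjI exI[of _ "\<epsilon> - d"]) auto
qed

section \<open>Convergence in distribution and Brownian motion\<close>

definition borel_of :: "'b topology \<Rightarrow> 'b measure" where
  "borel_of T = sigma (topspace T) {U. openin T U}"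

text \<open>The random elements may live on different probability spaces; measurability is
  part of the definition.\<close>

definition converges_in_distribution ::
  "'b topology \<Rightarrow> (nat \<Rightarrow> 'a measure) \<Rightarrow> (nat \<Rightarrow> 'a \<Rightarrow> 'b) \<Rightarrow> 'c measure \<Rightarrow> ('c \<Rightarrow> 'b) \<Rightarrow> bool" where
  "converges_in_distribution T M Y P Z \<longleftrightarrow>
     (\<forall>\<^sub>F m in sequentially. Y m \<in> measurable (M m) (borel_of T)) \<and>
     Z \<in> measurable P (borel_of T) \<and>
     (\<forall>F. continuous_map T euclideanreal F \<and> bounded (F ` topspace T) \<longrightarrow>
        (\<lambda>m. LINT \<omega>|M m. F (Y m \<omega>)) \<longlonglongrightarrow> (LINT \<omega>|P. F (Z \<omega>)))"

definition standard_brownian_motion :: "'c measure \<Rightarrow> (real \<Rightarrow> 'c \<Rightarrow> real) \<Rightarrow> bool" where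
  "standard_brownian_motion P B \<longleftrightarrow>
     prob_space P \<and>
     (\<forall>t\<ge>0. B t \<in> borel_measurable P) \<and>
     (AE \<omega> in P. B 0 \<omega> = 0) \<and>
     (\<forall>(n::nat) (t::nat \<Rightarrow> real). 0 \<le> t 0 \<and> (\<forall>i<n. t i \<le> t (Suc i)) \<longrightarrow>
        prob_space.indep_vars P (\<lambda>_. borel) (\<lambda>i \<omega>. B (t (Suc i)) \<omega> - B (t i) \<omega>) {..<n}) \<and>
     (\<forall>s t. 0 \<le> s \<and> s < t \<longrightarrow>
        distributed P lborel (\<lambda>\<omega>. B t \<omega> - B s \<omega>) (\<lambda>x. ennreal (normal_density 0 (sqrt (t - s)) x))) \<and>
     (\<forall>\<omega>\<in>space P. continuous_on {0..} (\<lambda>t. B t \<omega>))"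

end

theory Submission
  imports Defs
begin

text \<open>
  The increments of the walk number \<open>m\<close> are bounded by one constant \<open>K\<close>, have mean exactly
  \<open>-\<beta> / (2 \<surd>m)\<close> and second moments that tend to \<open>\<sigma>\<^sup>2\<close>.  This is read off the formula that
  specifies their law: the two weights there add up to \<open>1\<close>, the test function \<open>x\<close> leaves only the
  drift term, and \<open>x\<^sup>2\<close> leaves \<open>-u v\<close> and a remainder of order \<open>1 / \<surd>m\<close> (lemma
  \<open>is_mu_m_moments\<close>).  So the theorem is an instance of an invariance principle for rows of bounded
  independent variables with drift (\<open>walk_converges_to_brownian_motion_with_drift\<close>).

  The limit has continuous paths, and both the walks and the limit can be treated in the topology of
  locally uniform convergence, which is finer than the Skorokhod topology; \<open>lu_dist\<close> is a metric for
  it.  A bounded functional that is continuous for the Skorokhod topology is therefore continuous for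
  \<open>lu_dist\<close>, and it is the limit from below of bounded Lipschitz functionals, its inf-convolutions
  with multiples of the distance (\<open>lsc_lipschitz_approx\<close>).  Applied to \<open>F\<close> and \<open>-F\<close> this reduces
  convergence in distribution to the functionals that are bounded and Lipschitz for \<open>lu_dist\<close>; applied
  to indicators of open sets it reduces Borel measurability to the measurability of such functionals.

  For a bounded Lipschitz functional \<open>G\<close> the walk \<open>Y\<close> and the limit \<open>Z\<close> are compared through the step
  paths \<open>grid_path q Y\<close> and \<open>grid_path q Z\<close> that remember a path only at the times \<open>j / q\<close> with
  \<open>j \<le> q\<^sup>2\<close>:
  \<^item> \<open>E G(grid_path q Z) \<rightarrow> E G(Z)\<close> as \<open>q \<rightarrow> \<infinity>\<close>, as the paths of \<open>Z\<close> are continuous.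
  \<^item> \<open>E G(grid_path q Y) \<rightarrow> E G(grid_path q Z)\<close> for every fixed \<open>q\<close>: this expectation depends
    continuously on finitely many independent increments, and each of them satisfies a central limit
    theorem (\<open>bounded_rows_central_limit\<close>, \<open>weak_conv_independent_components\<close>).
  \<^item> \<open>E G(Y) - E G(grid_path q Y)\<close> is small for large \<open>q\<close>, uniformly over all walks with at least \<open>q\<close>
    steps per unit of time.  The walk moves by more than \<open>e\<close> during one of the \<open>q\<^sup>2\<close> time steps with
    probability at most \<open>6 q\<^sup>2 exp (- c q)\<close>, by the inequalities of Etemadi and Hoeffding
    (\<open>partial_sum_oscillation_tail\<close>).
\<close>

section \<open>The metric of locally uniform convergence\<close>

text \<open>
  A metric for locally uniform convergence.  The cap \<open>1 / (1 + t)\<close> makes the supremum finite and late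
  times negligible; as it enters through a minimum, \<open>\<bar>x t - y t\<bar> \<le> e\<close> up to the time \<open>1 / e\<close> already
  gives \<open>lu_dist x y \<le> e\<close>.
\<close>

definition lu_dist :: "(real \<Rightarrow> real) \<Rightarrow> (real \<Rightarrow> real) \<Rightarrow> real" where
  "lu_dist x y = (SUP t\<in>{0..}. min (1 / (1 + t)) \<bar>x t - y t\<bar>)"

lemma lu_dist_bdd_above: "bdd_above ((\<lambda>t. min (1 / (1 + t)) \<bar>x t - y t\<bar>) ` {0::real..})"
proof (rule bdd_aboveI2)
  fix t :: real assume "t \<in> {0..}"
  then have "1 / (1 + t) \<le> 1" by simp
  then show "min (1 / (1 + t)) \<bar>x t - y t\<bar> \<le> 1" by linarith
qed

lemma lu_dist_upper: "t \<ge> 0 \<Longrightarrow> min (1 / (1 + t)) \<bar>x t - y t\<bar> \<le> lu_dist x y"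
  unfolding lu_dist_def by (rule cSUP_upper[OF _ lu_dist_bdd_above]) auto

lemma lu_dist_least: "(\<And>t. t \<ge> 0 \<Longrightarrow> min (1 / (1 + t)) \<bar>x t - y t\<bar> \<le> e) \<Longrightarrow> lu_dist x y \<le> e"
  unfolding lu_dist_def by (rule cSUP_least) auto

lemma lu_dist_nonneg: "0 \<le> lu_dist x y"
proof -
  have "0 \<le> min (1 / (1 + 0)) \<bar>x 0 - y 0\<bar>" by simp
  also have "\<dots> \<le> lu_dist x y" by (rule lu_dist_upper) simp
  finally show ?thesis .
qed

lemma lu_dist_self [simp]: "lu_dist x x = 0"
  by (rule antisym[OF lu_dist_least lu_dist_nonneg]) auto

lemma lu_dist_commute: "lu_dist x y = lu_dist y x"
  unfolding lu_dist_def by (simp add: abs_minus_commute)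

lemma lu_dist_triangle: "lu_dist x z \<le> lu_dist x y + lu_dist y z"
proof (rule lu_dist_least)
  fix t :: real assume t: "t \<ge> 0"
  have "\<bar>x t - z t\<bar> \<le> \<bar>x t - y t\<bar> + \<bar>y t - z t\<bar>" by linarith
  moreover have "0 \<le> 1 / (1 + t)" using t by simp
  ultimately have "min (1 / (1 + t)) \<bar>x t - z t\<bar>
      \<le> min (1 / (1 + t)) \<bar>x t - y t\<bar> + min (1 / (1 + t)) \<bar>y t - z t\<bar>"
    by linarith
  also have "\<dots> \<le> lu_dist x y + lu_dist y z"
    by (intro add_mono lu_dist_upper t)
  finally show "min (1 / (1 + t)) \<bar>x t - z t\<bar> \<le> lu_dist x y + lu_dist y z" .
qed

lemma lu_dist_leI:
  assumes "1 / (1 + T) \<le> e" "T \<ge> 0" "\<And>t. 0 \<le> t \<Longrightarrow> t < T \<Longrightarrow> \<bar>x t - y t\<bar> \<le> e"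
  shows "lu_dist x y \<le> e"
proof (rule lu_dist_least)
  fix t :: real assume t: "t \<ge> 0"
  show "min (1 / (1 + t)) \<bar>x t - y t\<bar> \<le> e"
  proof (cases "t < T")
    case True then show ?thesis using assms(3)[of t] t by linarith
  next
    case False
    then have "1 / (1 + t) \<le> 1 / (1 + T)" using \<open>T \<ge> 0\<close> by (intro divide_left_mono) auto
    then show ?thesis using assms(1) by linarith
  qed
qed

lemma lu_dist_tendsto_0:
  assumes "\<And>T e. e > 0 \<Longrightarrow> \<forall>\<^sub>F n in F. \<forall>t. 0 \<le> t \<and> t < T \<longrightarrow> \<bar>x n t - y t\<bar> \<le> e"
  shows "((\<lambda>n. lu_dist (x n) y) \<longlongrightarrow> 0) F"
proof (rule order_tendstoI)
  fix a :: real assume "a < 0"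
  then show "\<forall>\<^sub>F n in F. a < lu_dist (x n) y"
    using lu_dist_nonneg order_less_le_trans by (intro always_eventually) blast
next
  fix a :: real assume a: "0 < a"
  define T where "T = 2 / a"
  have T: "T \<ge> 0" "1 / (1 + T) \<le> a / 2" using a by (auto simp: T_def field_simps)
  have "\<forall>\<^sub>F n in F. \<forall>t. 0 \<le> t \<and> t < T \<longrightarrow> \<bar>x n t - y t\<bar> \<le> a / 2"
    using a by (intro assms) auto
  then show "\<forall>\<^sub>F n in F. lu_dist (x n) y < a"
  proof eventually_elim
    case (elim n)
    then have "lu_dist (x n) y \<le> a / 2" using T by (intro lu_dist_leI) auto
    then show ?case using a by simp
  qed
qed

text \<open>
  The identity is an admissible time change, so that locally uniform closeness implies closeness for
  the Skorokhod topology.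
\<close>

lemma lu_ball_subset_skorokhod_nhd:
  assumes "T \<ge> 0" "e > 0"
  shows "\<exists>d>0. \<forall>y\<in>cadlag. lu_dist x y < d \<longrightarrow> y \<in> skorokhod_nhd x T e"
proof (intro exI[of _ "min e (1 / (1 + T))"] conjI ballI impI)
  show "min e (1 / (1 + T)) > 0" using assms by simp
  fix y assume y: "y \<in> cadlag" and d: "lu_dist x y < min e (1 / (1 + T))"
  have "\<bar>y s - x s\<bar> \<le> lu_dist x y" if s: "s \<in> {0..T}" for s
  proof -
    have "min (1 / (1 + s)) \<bar>x s - y s\<bar> \<le> lu_dist x y"
      using s by (intro lu_dist_upper) auto
    moreover have "1 / (1 + T) \<le> 1 / (1 + s)" using s by (intro divide_left_mono) auto
    ultimately show ?thesis using d by linarith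
  qed
  moreover have "id \<in> time_changes" by (auto simp: time_changes_def strict_mono_on_def)
  moreover have "lu_dist x y < e" using d by simp
  ultimately show "y \<in> skorokhod_nhd x T e"
    unfolding skorokhod_nhd_def using y lu_dist_nonneg[of x y]
    by (auto intro!: bexI[of _ id] exI[of _ "lu_dist x y"])
qed

lemma openin_skorokhod_lu_ball:
  assumes "openin skorokhod U" "x \<in> U"
  shows "\<exists>d>0. \<forall>y\<in>cadlag. lu_dist x y < d \<longrightarrow> y \<in> U"
proof -
  obtain T e where "T \<ge> 0" "e > 0" "skorokhod_nhd x T e \<subseteq> U"
    using assms unfolding openin_skorokhod by blast
  then show ?thesis using lu_ball_subset_skorokhod_nhd[of T e x] by blast
qed

section \<open>Reduction to Lipschitz functionals\<close>

definition bdd_lipschitz :: "((real \<Rightarrow> real) \<Rightarrow> real) \<Rightarrow> bool" where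
  "bdd_lipschitz G \<longleftrightarrow> (\<exists>C. \<forall>x\<in>cadlag. \<bar>G x\<bar> \<le> C) \<and>
     (\<exists>L. \<forall>x\<in>cadlag. \<forall>y\<in>cadlag. \<bar>G x - G y\<bar> \<le> L * lu_dist x y)"

lemma bdd_lipschitzE:
  assumes "bdd_lipschitz G"
  obtains C L where "C > 0" "L > 0" "\<And>x. x \<in> cadlag \<Longrightarrow> \<bar>G x\<bar> \<le> C"
    "\<And>x y. x \<in> cadlag \<Longrightarrow> y \<in> cadlag \<Longrightarrow> \<bar>G x - G y\<bar> \<le> L * lu_dist x y"
proof -
  obtain C L where C: "\<And>x. x \<in> cadlag \<Longrightarrow> \<bar>G x\<bar> \<le> C"
    and L: "\<And>x y. x \<in> cadlag \<Longrightarrow> y \<in> cadlag \<Longrightarrow> \<bar>G x - G y\<bar> \<le> L * lu_dist x y"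
    using assms unfolding bdd_lipschitz_def by blast
  have "\<bar>G x - G y\<bar> \<le> max 1 L * lu_dist x y" if "x \<in> cadlag" "y \<in> cadlag" for x y
    by (rule order_trans[OF L[OF that]]) (intro mult_right_mono lu_dist_nonneg, simp)
  then show thesis using C by (intro that[of "max 1 C" "max 1 L"]) (auto simp: le_max_iff_disj)
qed

lemma bdd_lipschitz_tendsto:
  assumes "bdd_lipschitz G" "\<And>n. x n \<in> cadlag" "y \<in> cadlag" "((\<lambda>n. lu_dist (x n) y) \<longlongrightarrow> 0) F"
  shows "((\<lambda>n. G (x n)) \<longlongrightarrow> G y) F"
proof -
  obtain C L where L: "\<And>x y. x \<in> cadlag \<Longrightarrow> y \<in> cadlag \<Longrightarrow> \<bar>G x - G y\<bar> \<le> L * lu_dist x y"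
    using bdd_lipschitzE[OF assms(1)] by metis
  have "((\<lambda>n. L * lu_dist (x n) y) \<longlongrightarrow> 0) F"
    using tendsto_mult_left[OF assms(4), of L] by simp
  then have "((\<lambda>n. G (x n) - G y) \<longlongrightarrow> 0) F"
    by (rule Lim_null_comparison[rotated]) (use L assms in auto)
  then show ?thesis by (simp add: LIM_zero_iff)
qed

text \<open>
  The approximation is the inf-convolution \<open>G n x = (INF y. F y + n * lu_dist x y)\<close>.  It is Lipschitz
  with constant \<open>n\<close> by the triangle inequality and lies below \<open>F\<close> (take \<open>y = x\<close>).  It converges to \<open>F x\<close>
  because for large \<open>n\<close> only those \<open>y\<close> count that are so close to \<open>x\<close> that lower semicontinuity applies.
  Lower semicontinuity is the right generality: it covers indicators of open sets as well as
  continuous functionals.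
\<close>

lemma lsc_lipschitz_approx:
  fixes F :: "(real \<Rightarrow> real) \<Rightarrow> real"
  assumes bdd: "\<And>x. x \<in> cadlag \<Longrightarrow> \<bar>F x\<bar> \<le> C"
    and lsc: "\<And>x e. x \<in> cadlag \<Longrightarrow> e > 0 \<Longrightarrow>
       \<exists>d>0. \<forall>y\<in>cadlag. lu_dist x y < d \<longrightarrow> F x - e < F y"
  obtains G where "\<And>n. bdd_lipschitz (G n)" "\<And>n x. x \<in> cadlag \<Longrightarrow> - C \<le> G n x \<and> G n x \<le> F x"
    "\<And>x. x \<in> cadlag \<Longrightarrow> (\<lambda>n. G n x) \<longlonglongrightarrow> F x"
proof
  define G where "G n x = (INF y\<in>cadlag. F y + real n * lu_dist x y)" for n x
  have low: "- C \<le> F y + real n * lu_dist x y" if "y \<in> cadlag" for n x y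
    using bdd[OF that] lu_dist_nonneg[of x y] mult_nonneg_nonneg[of "real n" "lu_dist x y"]
    by linarith
  have bb: "bdd_below ((\<lambda>y. F y + real n * lu_dist x y) ` cadlag)" for n x
    using low by (intro bdd_belowI2[of _ "- C"]) auto
  have G_le: "G n x \<le> F y + real n * lu_dist x y" if "y \<in> cadlag" for n x y
    unfolding G_def by (rule cINF_lower[OF bb that])
  have G_ge: "c \<le> G n x" if "x \<in> cadlag" "\<And>y. y \<in> cadlag \<Longrightarrow> c \<le> F y + real n * lu_dist x y" for c n x
    unfolding G_def using that by (intro cINF_greatest) auto
  show bounds: "- C \<le> G n x \<and> G n x \<le> F x" if "x \<in> cadlag" for n x
    using G_ge[OF that low] G_le[OF that, of n x] by simp
  have lip: "G n x - G n z \<le> real n * lu_dist x z" if "x \<in> cadlag" "z \<in> cadlag" for n x z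
  proof -
    have "G n x - real n * lu_dist x z \<le> F y + real n * lu_dist z y" if "y \<in> cadlag" for y
    proof -
      have "real n * lu_dist x y \<le> real n * (lu_dist x z + lu_dist z y)"
        by (intro mult_left_mono lu_dist_triangle) simp
      then show ?thesis using G_le[OF that, of n x] by (simp add: algebra_simps)
    qed
    then have "G n x - real n * lu_dist x z \<le> G n z" by (rule G_ge[OF \<open>z \<in> cadlag\<close>])
    then show ?thesis by simp
  qed
  show "bdd_lipschitz (G n)" for n
    unfolding bdd_lipschitz_def
  proof (intro conjI exI ballI)
    show "\<bar>G n x\<bar> \<le> C" if "x \<in> cadlag" for x using bounds[OF that, of n] bdd[OF that] by linarith
    show "\<bar>G n x - G n y\<bar> \<le> real n * lu_dist x y" if "x \<in> cadlag" "y \<in> cadlag" for x y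
      using lip[OF that, of n] lip[OF that(2,1), of n] by (simp add: abs_le_iff lu_dist_commute)
  qed
  show "(\<lambda>n. G n x) \<longlonglongrightarrow> F x" if x: "x \<in> cadlag" for x
  proof (rule order_tendstoI)
    fix a assume "F x < a" then show "\<forall>\<^sub>F n in sequentially. G n x < a"
      using bounds[OF x] by (intro always_eventually) (meson order_le_less_trans)
  next
    fix a assume a: "a < F x"
    define e where "e = (F x - a) / 2"
    have e: "e > 0" using a by (simp add: e_def)
    obtain d where d: "d > 0" "\<And>y. y \<in> cadlag \<Longrightarrow> lu_dist x y < d \<Longrightarrow> F x - e < F y"
      using lsc[OF x e] by blast
    \<comment> \<open>Far from \<open>x\<close> the penalty alone makes up for the oscillation \<open>2 C\<close> of \<open>F\<close>.\<close>
    have "\<forall>\<^sub>F n in sequentially. 2 * C / d \<le> real n"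
      using eventually_ge_at_top[of "nat \<lceil>2 * C / d\<rceil>"] by eventually_elim linarith
    then show "\<forall>\<^sub>F n in sequentially. a < G n x"
    proof eventually_elim
      case (elim n)
      have "F x - e \<le> F y + real n * lu_dist x y" if y: "y \<in> cadlag" for y
      proof (cases "lu_dist x y < d")
        case True
        then show ?thesis using d(2)[OF y True] mult_nonneg_nonneg[of "real n" "lu_dist x y"]
          lu_dist_nonneg[of x y] by linarith
      next
        case False
        have "2 * C \<le> real n * d" using elim d(1) by (simp add: field_simps)
        also have "\<dots> \<le> real n * lu_dist x y" using False by (intro mult_left_mono) auto
        finally show ?thesis using bdd[OF x] bdd[OF y] e by linarith
      qed
      then have "F x - e \<le> G n x" by (rule G_ge[OF x])
      then show ?case using a by (simp add: e_def field_simps)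
    qed
  qed
qed

text \<open>
  The indicator of an open set is a limit of Lipschitz functionals.
\<close>

lemma measurable_skorokhodI:
  assumes cad: "\<And>\<omega>. \<omega> \<in> space M \<Longrightarrow> Y \<omega> \<in> cadlag"
    and meas: "\<And>G. bdd_lipschitz G \<Longrightarrow> (\<lambda>\<omega>. G (Y \<omega>)) \<in> borel_measurable M"
  shows "Y \<in> measurable M (borel_of skorokhod)"
  unfolding borel_of_def
proof (rule measurable_measure_of)
  show "{U. openin skorokhod U} \<subseteq> Pow (topspace skorokhod)" using openin_subset by auto
  show "Y \<in> space M \<rightarrow> topspace skorokhod" using cad by (auto simp: topspace_skorokhod)
  fix U assume "U \<in> {U. openin skorokhod U}"
  then have U: "openin skorokhod U" by simp
  have "\<exists>d>0. \<forall>y\<in>cadlag. lu_dist x y < d \<longrightarrow> indicator U x - e < (indicator U y :: real)"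
    if "x \<in> cadlag" "e > 0" for x and e :: real
  proof (cases "x \<in> U")
    case True
    show ?thesis using openin_skorokhod_lu_ball[OF U True] that(2) True
      by (auto simp: indicator_def)
  next
    case False
    then show ?thesis using that(2) by (auto simp: indicator_def intro!: exI[of _ 1])
  qed
  then obtain G where G: "\<And>n. bdd_lipschitz (G n)"
    "\<And>x. x \<in> cadlag \<Longrightarrow> (\<lambda>n. G n x) \<longlonglongrightarrow> (indicator U x :: real)"
    using lsc_lipschitz_approx[of "indicator U" 1] by (metis abs_indicator indicator_le_1)
  have "(\<lambda>\<omega>. indicator U (Y \<omega>) :: real) \<in> borel_measurable M"
    by (rule borel_measurable_LIMSEQ_real[OF G(2)[OF cad] meas[OF G(1)]])
  then have "(\<lambda>\<omega>. indicator U (Y \<omega>) :: real) -` {1} \<inter> space M \<in> sets M"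
    by (rule measurable_sets) simp
  also have "(\<lambda>\<omega>. indicator U (Y \<omega>) :: real) -` {1} \<inter> space M = Y -` U \<inter> space M"
    by (auto simp: indicator_def split: if_splits)
  finally show "Y -` U \<inter> space M \<in> sets M" .
qed

lemma measurable_continuous_functional:
  assumes Y: "Y \<in> measurable M (borel_of skorokhod)" and F: "continuous_map skorokhod euclideanreal F"
  shows "(\<lambda>\<omega>. F (Y \<omega>)) \<in> borel_measurable M"
proof (rule measurable_compose[OF Y], rule borel_measurableI)
  fix S :: "real set" assume "open S"
  then have "openin skorokhod {x \<in> topspace skorokhod. F x \<in> S}"
    using F by (intro openin_continuous_map_preimage[of _ euclideanreal]) auto
  then have "{x \<in> topspace skorokhod. F x \<in> S} \<in> sets (borel_of skorokhod)"
    unfolding borel_of_def using openin_subset by (subst sets_measure_of) auto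
  moreover have "space (borel_of skorokhod) = topspace skorokhod"
    unfolding borel_of_def using openin_subset by (intro space_measure_of) auto
  ultimately show "F -` S \<inter> space (borel_of skorokhod) \<in> sets (borel_of skorokhod)"
    by (simp add: vimage_def Int_def conj_commute)
qed

text \<open>
  A Lipschitz minorant \<open>G\<close> of \<open>F\<close> with \<open>E G(Z)\<close> close to \<open>E F(Z)\<close> bounds \<open>E F(Y m)\<close> from below for
  large \<open>m\<close>; the upper bound is the same statement for \<open>-F\<close>.
\<close>

theorem converges_in_distribution_skorokhodI:
  fixes M :: "nat \<Rightarrow> 'a measure" and P :: "'c measure"
  assumes probM: "\<And>m. prob_space (M m)" and probP: "prob_space P"
    and cadY: "\<And>m \<omega>. \<omega> \<in> space (M m) \<Longrightarrow> Y m \<omega> \<in> cadlag" 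
    and cadZ: "\<And>\<omega>. \<omega> \<in> space P \<Longrightarrow> Z \<omega> \<in> cadlag"
    and measY: "\<And>G m. bdd_lipschitz G \<Longrightarrow> (\<lambda>\<omega>. G (Y m \<omega>)) \<in> borel_measurable (M m)"
    and measZ: "\<And>G. bdd_lipschitz G \<Longrightarrow> (\<lambda>\<omega>. G (Z \<omega>)) \<in> borel_measurable P"
    and conv: "\<And>G. bdd_lipschitz G \<Longrightarrow> (\<lambda>m. LINT \<omega>|M m. G (Y m \<omega>)) \<longlonglongrightarrow> (LINT \<omega>|P. G (Z \<omega>))"
  shows "converges_in_distribution skorokhod M Y P Z"
proof -
  interpret M: prob_space "M m" for m by fact
  interpret P: prob_space P by fact
  have Y: "Y m \<in> measurable (M m) (borel_of skorokhod)" for m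
    by (rule measurable_skorokhodI) (use cadY measY in auto)
  have Z: "Z \<in> measurable P (borel_of skorokhod)"
    by (rule measurable_skorokhodI) (use cadZ measZ in auto)
  have lower: "\<forall>\<^sub>F m in sequentially. a < (LINT \<omega>|M m. F (Y m \<omega>))"
    if F: "continuous_map skorokhod euclideanreal F" and C: "\<And>x. x \<in> cadlag \<Longrightarrow> \<bar>F x\<bar> \<le> C"
      and a: "a < (LINT \<omega>|P. F (Z \<omega>))" for F C a
  proof -
    have "\<exists>d>0. \<forall>y\<in>cadlag. lu_dist x y < d \<longrightarrow> F x - e < F y" if "x \<in> cadlag" "e > 0" for x e
    proof -
      have "openin skorokhod {y \<in> topspace skorokhod. F y \<in> {F x - e<..}}"
        using F by (intro openin_continuous_map_preimage[of _ euclideanreal]) auto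
      from openin_skorokhod_lu_ball[OF this, of x] that show ?thesis
        by (auto simp: topspace_skorokhod)
    qed
    then obtain G where G: "\<And>n. bdd_lipschitz (G n)"
      "\<And>n x. x \<in> cadlag \<Longrightarrow> - C \<le> G n x \<and> G n x \<le> F x"
      "\<And>x. x \<in> cadlag \<Longrightarrow> (\<lambda>n. G n x) \<longlonglongrightarrow> F x"
      using lsc_lipschitz_approx[of F C] C by metis
    have G_le: "\<bar>G n x\<bar> \<le> C" if "x \<in> cadlag" for n x using G(2)[OF that, of n] C[OF that] by linarith
    have "(\<lambda>n. LINT \<omega>|P. G n (Z \<omega>)) \<longlonglongrightarrow> (LINT \<omega>|P. F (Z \<omega>))"
    proof (rule integral_dominated_convergence[where w="\<lambda>_. C"])
      show "(\<lambda>\<omega>. F (Z \<omega>)) \<in> borel_measurable P" by (rule measurable_continuous_functional[OF Z F])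
    qed (use G G_le measZ cadZ in auto)
    then obtain n where n: "a < (LINT \<omega>|P. G n (Z \<omega>))"
      using order_tendstoD(1)[OF _ a] eventually_happens'[OF sequentially_bot] by blast
    have "\<forall>\<^sub>F m in sequentially. a < (LINT \<omega>|M m. G n (Y m \<omega>))"
      using order_tendstoD(1)[OF conv[OF G(1)] n] .
    then show ?thesis
    proof eventually_elim
      case (elim m)
      have "(LINT \<omega>|M m. G n (Y m \<omega>)) \<le> (LINT \<omega>|M m. F (Y m \<omega>))"
      proof (rule integral_mono)
        show "integrable (M m) (\<lambda>\<omega>. G n (Y m \<omega>))"
          by (rule M.integrable_const_bound[where B=C]) (use G_le cadY measY[OF G(1)] in auto)
        show "integrable (M m) (\<lambda>\<omega>. F (Y m \<omega>))"
          by (rule M.integrable_const_bound[where B=C])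
             (use C cadY measurable_continuous_functional[OF Y F] in auto)
      qed (use G(2) cadY in auto)
      then show ?case using elim by simp
    qed
  qed
  show ?thesis
    unfolding converges_in_distribution_def
  proof (intro conjI allI impI always_eventually Y Z; elim conjE)
    fix F assume F: "continuous_map skorokhod euclideanreal F" and "bounded (F ` topspace skorokhod)"
    then obtain C where C: "\<And>x. x \<in> cadlag \<Longrightarrow> \<bar>F x\<bar> \<le> C"
      by (auto simp: bounded_iff topspace_skorokhod)
    show "(\<lambda>m. LINT \<omega>|M m. F (Y m \<omega>)) \<longlonglongrightarrow> (LINT \<omega>|P. F (Z \<omega>))"
    proof (rule order_tendstoI)
      fix a assume "a < (LINT \<omega>|P. F (Z \<omega>))"
      then show "\<forall>\<^sub>F m in sequentially. a < (LINT \<omega>|M m. F (Y m \<omega>))" using lower[OF F C] by blast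
    next
      fix a assume "(LINT \<omega>|P. F (Z \<omega>)) < a"
      then have "\<forall>\<^sub>F m in sequentially. - a < (LINT \<omega>|M m. - F (Y m \<omega>))"
        using lower[of "\<lambda>x. - F x" C "- a"] F C by (auto intro: continuous_map_minus)
      then show "\<forall>\<^sub>F m in sequentially. (LINT \<omega>|M m. F (Y m \<omega>)) < a" by simp
    qed
  qed
qed

section \<open>Step paths and discretization of paths\<close>

text \<open>
  Rescaled random walks and discretizations of paths are both of this form, with the sequence \<open>a\<close>
  carrying the randomness.
\<close>

definition step_path :: "nat \<Rightarrow> (nat \<Rightarrow> real) \<Rightarrow> real \<Rightarrow> real" where
  "step_path n a = (\<lambda>t\<in>{0..}. a (nat \<lfloor>real n * t\<rfloor>))"

lemma eventually_floor_at_right: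
  fixes x :: real shows "\<forall>\<^sub>F y in at_right x. \<lfloor>y\<rfloor> = \<lfloor>x\<rfloor>"
proof -
  have "\<forall>\<^sub>F y in at_right x. y < of_int \<lfloor>x\<rfloor> + 1"
    by (rule order_tendstoD[OF tendsto_ident_at]) linarith
  moreover have "\<forall>\<^sub>F y in at_right x. x < y" by (rule eventually_at_right_less)
  ultimately show ?thesis by eventually_elim linarith
qed

lemma eventually_floor_at_left:
  fixes x :: real shows "\<exists>k. \<forall>\<^sub>F y in at_left x. \<lfloor>y\<rfloor> = k"
proof
  have "\<forall>\<^sub>F y in at_left x. of_int (\<lceil>x\<rceil> - 1) < y"
    by (rule order_tendstoD[OF tendsto_ident_at]) linarith
  moreover have "\<forall>\<^sub>F y in at_left x. y < x" by (simp add: eventually_at_filter)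
  ultimately show "\<forall>\<^sub>F y in at_left x. \<lfloor>y\<rfloor> = \<lceil>x\<rceil> - 1" by eventually_elim linarith
qed

lemma filterlim_mult_at_right_left:
  fixes c :: real assumes "c > 0"
  shows "filterlim (\<lambda>s. c * s) (at_right (c * t)) (at_right t)"
    "filterlim (\<lambda>s. c * s) (at_left (c * t)) (at_left t)"
  using assms by (auto simp: filterlim_at eventually_at_filter intro!: tendsto_eq_intros)

lemma step_path_in_cadlag: "step_path n a \<in> cadlag"
proof -
  have "(step_path n a \<longlongrightarrow> step_path n a t) (at_right t)" if "t \<ge> 0" for t
  proof (rule tendsto_eventually)
    have "\<forall>\<^sub>F s in at_right t. \<lfloor>real n * s\<rfloor> = \<lfloor>real n * t\<rfloor>"
      using filterlim_mult_at_right_left(1)[of "real n" t] eventually_floor_at_right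
      by (cases "n = 0") (auto simp: filterlim_iff)
    with eventually_at_right_less[of t] show "\<forall>\<^sub>F s in at_right t. step_path n a s = step_path n a t"
      by eventually_elim (use that in \<open>auto simp: step_path_def\<close>)
  qed
  moreover have "\<exists>l. (step_path n a \<longlongrightarrow> l) (at_left t)" if "t > 0" for t
  proof -
    obtain k where "\<forall>\<^sub>F y in at_left (real n * t). \<lfloor>y\<rfloor> = k" using eventually_floor_at_left by blast
    then have "\<exists>k. \<forall>\<^sub>F s in at_left t. \<lfloor>real n * s\<rfloor> = k"
      using filterlim_mult_at_right_left(2)[of "real n" t]
      by (cases "n = 0") (auto simp: filterlim_iff)
    then obtain k where "\<forall>\<^sub>F s in at_left t. \<lfloor>real n * s\<rfloor> = k" by blast
    moreover have "\<forall>\<^sub>F s in at_left t. 0 < s" by (rule order_tendstoD[OF tendsto_ident_at that])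
    ultimately have "\<forall>\<^sub>F s in at_left t. step_path n a s = a (nat k)"
      by eventually_elim (auto simp: step_path_def)
    then show ?thesis by (blast intro: tendsto_eventually)
  qed
  ultimately show ?thesis by (auto simp: cadlag_def step_path_def)
qed

lemma continuous_in_cadlag:
  assumes "continuous_on {0..} x"
  shows "(\<lambda>t\<in>{0..}. x t) \<in> cadlag"
proof -
  have cont: "((\<lambda>t\<in>{0..}. x t) \<longlongrightarrow> x t) (at t within {0..})" if "t \<ge> 0" for t
  proof (rule tendsto_cong[THEN iffD1])
    show "(x \<longlongrightarrow> x t) (at t within {0..})" using assms that by (auto simp: continuous_on_def)
    show "\<forall>\<^sub>F s in at t within {0..}. x s = (\<lambda>t\<in>{0..}. x t) s"
      by (auto simp: eventually_at_filter)
  qed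
  have "((\<lambda>t\<in>{0..}. x t) \<longlongrightarrow> x t) (at_right t)" if "t \<ge> 0" for t
    using cont[OF that] by (rule tendsto_within_subset) (use that in auto)
  moreover have "((\<lambda>t\<in>{0..}. x t) \<longlongrightarrow> x t) (at_left t)" if "t > 0" for t
  proof -
    have "at t within {0..} = at t" using that by (intro at_within_interior) simp
    then have "((\<lambda>t\<in>{0..}. x t) \<longlongrightarrow> x t) (at t)" using cont[of t] that by simp
    then show ?thesis by (rule tendsto_within_subset) simp
  qed
  ultimately show ?thesis by (auto simp: cadlag_def)
qed

lemma lu_dist_step_path_tendsto:
  assumes "\<And>j. (\<lambda>i. a i j) \<longlonglongrightarrow> b j"
  shows "(\<lambda>i. lu_dist (step_path n (a i)) (step_path n b)) \<longlonglongrightarrow> 0"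
proof (rule lu_dist_tendsto_0)
  fix T e :: real assume e: "e > 0"
  have "\<forall>\<^sub>F i in sequentially. \<forall>j\<in>{..nat \<lfloor>real n * T\<rfloor>}. \<bar>a i j - b j\<bar> < e"
    using assms e by (intro eventually_ball_finite) (auto simp: tendsto_iff dist_real_def)
  then show "\<forall>\<^sub>F i in sequentially. \<forall>t. 0 \<le> t \<and> t < T \<longrightarrow> \<bar>step_path n (a i) t - step_path n b t\<bar> \<le> e"
  proof eventually_elim
    case (elim i)
    show ?case
    proof (intro allI impI, elim conjE)
      fix t :: real assume t: "0 \<le> t" "t < T"
      then have "real n * t \<le> real n * T" by (intro mult_left_mono) auto
      then have "nat \<lfloor>real n * t\<rfloor> \<le> nat \<lfloor>real n * T\<rfloor>" by (intro nat_mono floor_mono)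
      then show "\<bar>step_path n (a i) t - step_path n b t\<bar> \<le> e"
        using bspec[OF elim, of "nat \<lfloor>real n * t\<rfloor>"] t by (simp add: step_path_def)
    qed
  qed
qed

text \<open>
  The map from the sequence \<open>a\<close> to the step path is continuous from the product topology, whose Borel
  sets are generated by the coordinates, to the topology of locally uniform convergence.
\<close>

lemma measurable_lipschitz_step_path:
  assumes G: "bdd_lipschitz G" and a: "\<And>j. (\<lambda>\<omega>. a \<omega> j) \<in> borel_measurable M"
  shows "(\<lambda>\<omega>. G (step_path n (a \<omega>))) \<in> borel_measurable M"
proof (rule measurable_compose[where f=a and N=borel])
  show "a \<in> borel_measurable M" by (rule measurable_coordinatewise_then_product) (rule a)
  have "continuous_on UNIV (\<lambda>a. G (step_path n a))"
  proof (rule continuous_on_sequentiallyI)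
    fix u :: "nat \<Rightarrow> nat \<Rightarrow> real" and a assume "u \<longlonglongrightarrow> a"
    then have "(\<lambda>i. u i j) \<longlonglongrightarrow> a j" for j
      by (rule continuous_on_tendsto_compose[OF continuous_on_product_coordinates]) auto
    then show "(\<lambda>i. G (step_path n (u i))) \<longlonglongrightarrow> G (step_path n a)"
      by (intro bdd_lipschitz_tendsto[OF G] step_path_in_cadlag lu_dist_step_path_tendsto)
  qed
  then show "(\<lambda>a. G (step_path n a)) \<in> borel_measurable borel"
    by (rule borel_measurable_continuous_onI)
qed

text \<open>
  The time horizon is \<open>q\<close> and the mesh \<open>1 / q\<close>, so that a single parameter makes the discretization
  converge locally uniformly while only finitely many values of the path enter.
\<close>

definition grid_path :: "nat \<Rightarrow> (real \<Rightarrow> real) \<Rightarrow> real \<Rightarrow> real" where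
  "grid_path q x = step_path q (\<lambda>j. x (real (min j (q * q)) / real q))"

lemma grid_path_in_cadlag: "grid_path n x \<in> cadlag"
  by (simp add: grid_path_def step_path_in_cadlag)

lemma grid_path_eq:
  assumes "0 \<le> t" "t < real n"
  shows "nat \<lfloor>real n * t\<rfloor> < n * n" "grid_path n x t = x (real (nat \<lfloor>real n * t\<rfloor>) / real n)"
proof -
  have "real n * t < real n * real n" using assms by (intro mult_strict_left_mono) auto
  then have "real (nat \<lfloor>real n * t\<rfloor>) < real (n * n)"
    using order_le_less_trans[OF of_int_floor_le[of "real n * t"]] assms by simp
  then show "nat \<lfloor>real n * t\<rfloor> < n * n" by (simp only: of_nat_less_iff)
  then show "grid_path n x t = x (real (nat \<lfloor>real n * t\<rfloor>) / real n)"
    using assms by (simp add: grid_path_def step_path_def min_def)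
qed

lemma lu_dist_grid_path_tendsto:
  assumes "continuous_on {0..} x"
  shows "(\<lambda>n. lu_dist (grid_path n (\<lambda>t\<in>{0..}. x t)) (\<lambda>t\<in>{0..}. x t)) \<longlonglongrightarrow> 0"
proof (rule lu_dist_tendsto_0)
  fix T e :: real assume e: "e > 0"
  have "uniformly_continuous_on {0..T} x"
    by (rule compact_uniformly_continuous) (auto intro: continuous_on_subset[OF assms])
  then obtain d where d: "d > 0"
    "\<And>s t. s \<in> {0..T} \<Longrightarrow> t \<in> {0..T} \<Longrightarrow> dist s t < d \<Longrightarrow> dist (x s) (x t) < e"
    using e unfolding uniformly_continuous_on_def by metis
  have "\<forall>\<^sub>F n in sequentially. max T (1 / d) < real n"
    by (rule filterlim_real_sequentially[unfolded filterlim_at_top_dense, rule_format])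
  then show "\<forall>\<^sub>F n in sequentially. \<forall>t. 0 \<le> t \<and> t < T \<longrightarrow>
    \<bar>grid_path n (\<lambda>t\<in>{0..}. x t) t - (\<lambda>t\<in>{0..}. x t) t\<bar> \<le> e"
  proof eventually_elim
    case (elim n)
    show ?case
    proof (intro allI impI, elim conjE)
      fix t assume t: "0 \<le> t" "t < T"
      define s where "s = real (nat \<lfloor>real n * t\<rfloor>) / real n"
      have n: "real n > 0" using t elim by simp
      have fl: "real (nat \<lfloor>real n * t\<rfloor>) = of_int \<lfloor>real n * t\<rfloor>" using t by simp
      have "s * real n = of_int \<lfloor>real n * t\<rfloor>" using n fl by (simp add: s_def)
      then have "s * real n \<le> t * real n" "t * real n < s * real n + 1"
        using real_of_int_floor_add_one_gt[of "t * real n"] of_int_floor_le[of "t * real n"]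
        by (simp_all add: mult.commute)
      then have "s \<le> t" "t < (s * real n + 1) / real n" using n by (simp_all add: less_divide_eq)
      then have "s \<le> t" "t < s + 1 / real n" using n by (simp_all add: add_divide_distrib)
      moreover have "1 / real n < d" using elim d(1) n by (simp add: field_simps)
      moreover have "s \<ge> 0" by (simp add: s_def)
      ultimately have "dist (x s) (x t) < e" using t by (intro d(2)) (auto simp: dist_real_def)
      moreover have "grid_path n (\<lambda>t\<in>{0..}. x t) t = x s"
        using grid_path_eq(2)[of t n "\<lambda>t\<in>{0..}. x t"] t elim \<open>s \<ge> 0\<close> by (simp add: s_def)
      ultimately show "\<bar>grid_path n (\<lambda>t\<in>{0..}. x t) t - (\<lambda>t\<in>{0..}. x t) t\<bar> \<le> e"
        using t by (simp add: dist_real_def)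
    qed
  qed
qed

lemma measurable_lipschitz_grid_path:
  assumes "bdd_lipschitz G" and "\<And>t. t \<ge> 0 \<Longrightarrow> (\<lambda>\<omega>. x \<omega> t) \<in> borel_measurable M"
  shows "(\<lambda>\<omega>. G (grid_path n (x \<omega>))) \<in> borel_measurable M"
  unfolding grid_path_def by (rule measurable_lipschitz_step_path) (use assms in auto)

lemma lipschitz_grid_path_tendsto:
  assumes "bdd_lipschitz G" "continuous_on {0..} x"
  shows "(\<lambda>n. G (grid_path n (\<lambda>t\<in>{0..}. x t))) \<longlonglongrightarrow> G (\<lambda>t\<in>{0..}. x t)"
  by (rule bdd_lipschitz_tendsto[OF assms(1) grid_path_in_cadlag continuous_in_cadlag[OF assms(2)]
        lu_dist_grid_path_tendsto[OF assms(2)]])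

text \<open>
  The path is the locally uniform limit of its discretizations, for which measurability is known.
\<close>

lemma measurable_lipschitz_continuous:
  assumes G: "bdd_lipschitz G" and x: "\<And>t. t \<ge> 0 \<Longrightarrow> (\<lambda>\<omega>. x \<omega> t) \<in> borel_measurable M"
    and cont: "\<And>\<omega>. \<omega> \<in> space M \<Longrightarrow> continuous_on {0..} (x \<omega>)"
  shows "(\<lambda>\<omega>. G (\<lambda>t\<in>{0..}. x \<omega> t)) \<in> borel_measurable M"
  by (rule borel_measurable_LIMSEQ_real[OF lipschitz_grid_path_tendsto[OF G cont]])
     (auto intro!: measurable_lipschitz_grid_path[OF G] x)

section \<open>Maximal inequality for sums of independent bounded variables\<close>

context prob_space begin

lemma indep_var_partial_sum_increment:
  fixes X :: "nat \<Rightarrow> 'a \<Rightarrow> real"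
  assumes indep: "indep_vars (\<lambda>_. borel) X {1..l}" and "k \<le> l"
    and f: "f \<in> borel_measurable (PiM {1..k} (\<lambda>_. borel))" and g: "g \<in> borel_measurable borel"
  shows "indep_var borel (\<lambda>\<omega>. f (\<lambda>i\<in>{1..k}. X i \<omega>)) borel (\<lambda>\<omega>. g (\<Sum>i\<in>{k<..l}. X i \<omega>))"
proof -
  have "indep_var borel (f \<circ> (\<lambda>\<omega>. \<lambda>i\<in>{1..k}. X i \<omega>))
      borel ((\<lambda>y. g (\<Sum>i\<in>{k<..l}. y i)) \<circ> (\<lambda>\<omega>. \<lambda>i\<in>{k<..l}. X i \<omega>))"
    using assms by (intro indep_var_compose[OF indep_var_restrict[OF indep]]) auto
  then show ?thesis by (simp add: comp_def)
qed

text \<open>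
  Decompose by the first index \<open>k\<close> at which \<open>\<bar>S k\<bar>\<close> reaches \<open>3 a\<close>.  Either \<open>\<bar>S l\<bar> \<ge> a\<close>, or the sum of
  the later summands exceeds \<open>2 a\<close> in absolute value.  That sum is independent of what happened up to
  \<open>k\<close>, and being the difference of \<open>S l\<close> and \<open>S k\<close> it is that large with probability at most \<open>2 q\<close>.
\<close>

theorem Etemadi_inequality:
  fixes X :: "nat \<Rightarrow> 'a \<Rightarrow> real"
  defines "S \<equiv> \<lambda>k \<omega>. \<Sum>i=1..k. X i \<omega>"
  assumes indep: "indep_vars (\<lambda>_. borel) X {1..l}" and "a > 0"
    and tail: "\<And>k. k \<le> l \<Longrightarrow> prob {\<omega> \<in> space M. a \<le> \<bar>S k \<omega>\<bar>} \<le> q"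
  shows "prob {\<omega> \<in> space M. \<exists>k\<le>l. 3 * a \<le> \<bar>S k \<omega>\<bar>} \<le> 3 * q"
proof -
  have X [measurable]: "X i \<in> borel_measurable M" if "i \<in> {1..l}" for i
    using indep that unfolding indep_vars_def by auto
  have S [measurable]: "S k \<in> borel_measurable M" if "k \<le> l" for k
    unfolding S_def using that by (intro borel_measurable_sum X) auto
  define A where "A k = {\<omega> \<in> space M. 3 * a \<le> \<bar>S k \<omega>\<bar> \<and> (\<forall>j<k. \<bar>S j \<omega>\<bar> < 3 * a)}" for k
  define R where "R k = {\<omega> \<in> space M. 2 * a \<le> \<bar>\<Sum>i\<in>{k<..l}. X i \<omega>\<bar>}" for k
  define L where "L = {\<omega> \<in> space M. a \<le> \<bar>S l \<omega>\<bar>}"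
  have A [measurable]: "A k \<in> events" if "k \<le> l" for k
  proof -
    have [measurable]: "S j \<in> borel_measurable M" if "j \<le> k" for j using that \<open>k \<le> l\<close> by simp
    have "A k = {\<omega> \<in> space M. 3 * a \<le> \<bar>S k \<omega>\<bar> \<and> (\<forall>j\<in>{..<k}. \<bar>S j \<omega>\<bar> < 3 * a)}"
      by (auto simp: A_def)
    also have "\<dots> \<in> events" by measurable
    finally show ?thesis .
  qed
  have R [measurable]: "R k \<in> events" for k
    unfolding R_def by measurable
  have L [measurable]: "L \<in> events" unfolding L_def by measurable
  have split: "S l \<omega> = S k \<omega> + (\<Sum>i\<in>{k<..l}. X i \<omega>)" if "k \<le> l" for k \<omega>
  proof -
    have "{1..l} = {1..k} \<union> {k<..l}" using that by auto
    then show ?thesis unfolding S_def by (simp add: sum.union_disjoint ivl_disj_int)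
  qed
  have q: "prob L \<le> q" "\<And>k. k \<le> l \<Longrightarrow> prob (R k) \<le> 2 * q"
  proof -
    show "prob L \<le> q" using tail[of l] by (simp add: L_def)
    fix k assume k: "k \<le> l"
    have "R k \<subseteq> L \<union> {\<omega> \<in> space M. a \<le> \<bar>S k \<omega>\<bar>}"
      using split[OF k] by (auto simp: R_def L_def)
    then have "prob (R k) \<le> prob (L \<union> {\<omega> \<in> space M. a \<le> \<bar>S k \<omega>\<bar>})"
      using k by (intro finite_measure_mono) measurable
    also have "\<dots> \<le> prob L + prob {\<omega> \<in> space M. a \<le> \<bar>S k \<omega>\<bar>}"
      using k by (intro measure_Un_le) measurable
    finally show "prob (R k) \<le> 2 * q" using \<open>prob L \<le> q\<close> tail[OF k] by simp
  qed
  \<comment> \<open>The event \<open>A k\<close> concerns the first \<open>k\<close> summands and \<open>R k\<close> the others.\<close>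
  have indep_AR: "prob (A k \<inter> R k) = prob (A k) * prob (R k)" if k: "k \<le> l" for k
  proof -
    define f :: "(nat \<Rightarrow> real) \<Rightarrow> real" where
      "f y = (if 3 * a \<le> \<bar>\<Sum>i=1..k. y i\<bar> \<and> (\<forall>j\<in>{..<k}. \<bar>\<Sum>i=1..j. y i\<bar> < 3 * a) then 1 else 0)" for y
    define g :: "real \<Rightarrow> real" where "g x = (if 2 * a \<le> \<bar>x\<bar> then 1 else 0)" for x
    have [measurable]: "(\<lambda>y. \<Sum>i=1..j. y i) \<in> borel_measurable (PiM {1..k} (\<lambda>_. borel :: real measure))"
      if "j \<le> k" for j
      using that by (intro borel_measurable_sum measurable_component_singleton) auto
    have "f \<in> borel_measurable (PiM {1..k} (\<lambda>_. borel))" unfolding f_def by measurable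
    moreover have "g \<in> borel_measurable borel" unfolding g_def by measurable
    ultimately have iv: "indep_var borel (\<lambda>\<omega>. f (\<lambda>i\<in>{1..k}. X i \<omega>)) borel (\<lambda>\<omega>. g (\<Sum>i\<in>{k<..l}. X i \<omega>))"
      by (rule indep_var_partial_sum_increment[OF indep k])
    have "f (\<lambda>i\<in>{1..k}. X i \<omega>) = indicator (A k) \<omega>" if "\<omega> \<in> space M" for \<omega>
    proof -
      have "(\<Sum>i=1..j. (\<lambda>i\<in>{1..k}. X i \<omega>) i) = S j \<omega>" if "j \<le> k" for j
        unfolding S_def using that by (intro sum.cong) auto
      then show ?thesis using that by (auto simp: f_def A_def indicator_def)
    qed
    moreover have "g (\<Sum>i\<in>{k<..l}. X i \<omega>) = indicator (R k) \<omega>" if "\<omega> \<in> space M" for \<omega>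
      using that by (auto simp: g_def R_def indicator_def)
    moreover have "expectation (\<lambda>\<omega>. f (\<lambda>i\<in>{1..k}. X i \<omega>) * g (\<Sum>i\<in>{k<..l}. X i \<omega>)) =
      expectation (\<lambda>\<omega>. f (\<lambda>i\<in>{1..k}. X i \<omega>)) * expectation (\<lambda>\<omega>. g (\<Sum>i\<in>{k<..l}. X i \<omega>))"
    proof (rule indep_var_lebesgue_integral[OF iv])
      show "integrable M (\<lambda>\<omega>. f (\<lambda>i\<in>{1..k}. X i \<omega>))"
        by (rule integrable_const_bound[where B=1])
           (use indep_var_rv1[OF iv] in \<open>auto simp: f_def\<close>)
      show "integrable M (\<lambda>\<omega>. g (\<Sum>i\<in>{k<..l}. X i \<omega>))"
        by (rule integrable_const_bound[where B=1])
           (use indep_var_rv2[OF iv] in \<open>auto simp: g_def\<close>)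
    qed
    ultimately have "expectation (\<lambda>\<omega>. indicator (A k) \<omega> * indicator (R k) \<omega> :: real) =
      expectation (indicator (A k)) * expectation (indicator (R k))"
      by (simp cong: Bochner_Integration.integral_cong)
    then show ?thesis using A[OF k] R[of k]
      by (simp add: indicator_inter_arith[symmetric] Int_absorb2 sets.sets_into_space le_infI1)
  qed
  have disj: "disjoint_family_on A {..l}"
    unfolding disjoint_family_on_def A_def
    by (auto simp: set_eq_iff) (metis linorder_neqE_nat not_le)
  have "{\<omega> \<in> space M. \<exists>k\<le>l. 3 * a \<le> \<bar>S k \<omega>\<bar>} \<subseteq> L \<union> (\<Union>k\<in>{..l}. A k \<inter> R k)"
  proof
    fix \<omega> assume "\<omega> \<in> {\<omega> \<in> space M. \<exists>k\<le>l. 3 * a \<le> \<bar>S k \<omega>\<bar>}"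
    then obtain k' where *: "\<omega> \<in> space M" "k' \<le> l" "3 * a \<le> \<bar>S k' \<omega>\<bar>" by blast
    define k where "k = (LEAST k. 3 * a \<le> \<bar>S k \<omega>\<bar>)"
    have k: "3 * a \<le> \<bar>S k \<omega>\<bar>" unfolding k_def by (rule LeastI[of "\<lambda>k. 3 * a \<le> \<bar>S k \<omega>\<bar>" k', OF *(3)])
    have "k \<le> l" unfolding k_def using Least_le[of "\<lambda>k. 3 * a \<le> \<bar>S k \<omega>\<bar>" k'] * by simp
    moreover have "\<bar>S j \<omega>\<bar> < 3 * a" if "j < k" for j
      using not_less_Least[of j "\<lambda>k. 3 * a \<le> \<bar>S k \<omega>\<bar>"] that unfolding k_def by simp
    ultimately have "\<omega> \<in> A k" "k \<in> {..l}" using k * by (auto simp: A_def)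
    moreover have "\<omega> \<in> L \<or> \<omega> \<in> R k"
      using k * split[OF \<open>k \<le> l\<close>, of \<omega>] by (auto simp: L_def R_def)
    ultimately show "\<omega> \<in> L \<union> (\<Union>k\<in>{..l}. A k \<inter> R k)" by blast
  qed
  then have "prob {\<omega> \<in> space M. \<exists>k\<le>l. 3 * a \<le> \<bar>S k \<omega>\<bar>} \<le> prob (L \<union> (\<Union>k\<in>{..l}. A k \<inter> R k))"
    by (intro finite_measure_mono sets.Un L sets.finite_UN sets.Int A R) auto
  also have "\<dots> \<le> prob L + prob (\<Union>k\<in>{..l}. A k \<inter> R k)"
    by (intro measure_Un_le L sets.finite_UN sets.Int A R) auto
  also have "prob (\<Union>k\<in>{..l}. A k \<inter> R k) \<le> (\<Sum>k\<in>{..l}. prob (A k \<inter> R k))"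
    by (intro finite_measure_subadditive_finite) (auto intro!: A R)
  also have "\<dots> \<le> (\<Sum>k\<in>{..l}. prob (A k) * (2 * q))"
    by (intro sum_mono) (auto simp: indep_AR intro!: mult_left_mono q)
  also have "\<dots> = prob (\<Union>k\<in>{..l}. A k) * (2 * q)"
    using finite_measure_finite_Union[OF _ _ disj] A by (simp add: sum_distrib_right image_subset_iff)
  also have "\<dots> \<le> 1 * (2 * q)"
    using q(1) measure_nonneg[of M L] by (intro mult_right_mono prob_le_1) linarith
  finally show ?thesis using q(1) by simp
qed

text \<open>
  Hoeffding's inequality at level \<open>a / 6\<close> bounds the deviation of each partial sum from its mean, which
  is itself at most \<open>a / 6\<close>; hence each partial sum exceeds \<open>a / 3\<close> with small probability, and
  Etemadi's inequality passes to the maximum.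
\<close>

lemma partial_sum_oscillation_tail:
  fixes X :: "nat \<Rightarrow> 'a \<Rightarrow> real"
  assumes indep: "indep_vars (\<lambda>_. borel) X {1..}" and K: "K > 0"
    and bdd: "\<And>i. i \<ge> 1 \<Longrightarrow> AE \<omega> in M. \<bar>X i \<omega>\<bar> \<le> K"
    and mean: "\<And>i. i \<ge> 1 \<Longrightarrow> \<bar>expectation (X i)\<bar> \<le> d"
    and a: "a > 0" and drift: "real l * d \<le> a / 6"
  shows "prob {\<omega> \<in> space M. \<exists>k\<le>l. a \<le> \<bar>\<Sum>i=1..k. X (L + i) \<omega>\<bar>} \<le> 6 * exp (- (a\<^sup>2 / (72 * real l * K\<^sup>2)))"
proof -
  define Y where "Y i = X (L + i)" for i
  have indepY: "indep_vars (\<lambda>_. borel) Y {1..l}"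
  proof -
    \<comment> \<open>Reindexing by \<open>i \<mapsto> L + i\<close>, through the blocks \<open>{L + i}\<close>.\<close>
    have "indep_vars (\<lambda>i. PiM {L + i} (\<lambda>_. borel)) (\<lambda>i \<omega>. \<lambda>j\<in>{L + i}. X j \<omega>) {1..l}"
      by (rule indep_vars_restrict[OF indep]) (auto simp: disjoint_family_on_def)
    then have "indep_vars (\<lambda>_. borel) (\<lambda>i \<omega>. (\<lambda>j\<in>{L + i}. X j \<omega>) (L + i)) {1..l}"
      by (rule indep_vars_compose2) auto
    then show ?thesis by (simp add: Y_def[abs_def])
  qed
  have "prob {\<omega> \<in> space M. a / 3 \<le> \<bar>\<Sum>i=1..k. Y i \<omega>\<bar>} \<le> 2 * exp (- (a\<^sup>2 / (72 * real l * K\<^sup>2)))"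
    if k: "k \<le> l" for k
  proof (cases "k = 0")
    case True
    then show ?thesis using a by simp
  next
    case False
    define m where "m = (\<Sum>i\<in>{1..k}. expectation (Y i))"
    interpret H: Hoeffding_ineq M "{1..k}" Y "\<lambda>_. - K" "\<lambda>_. K" m
    proof unfold_locales
      show "indep_vars (\<lambda>_. borel) Y {1..k}" using k by (intro indep_vars_subset[OF indepY]) auto
      show "AE \<omega> in M. Y i \<omega> \<in> {- K..K}" if "i \<in> {1..k}" for i
        using bdd[of "L + i"] that by (auto simp: Y_def abs_le_iff)
    qed (auto simp: m_def)
    have "\<bar>m\<bar> \<le> (\<Sum>i\<in>{1..k}. d)"
      unfolding m_def Y_def by (rule order_trans[OF sum_abs]) (intro sum_mono mean, auto)
    also have "\<dots> \<le> real l * d"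
      using k False mean[of 1] by (simp add: mult_right_mono)
    finally have m: "\<bar>m\<bar> \<le> a / 6" using drift by simp
    have [measurable]: "(\<lambda>\<omega>. \<Sum>i=1..k. Y i \<omega>) \<in> borel_measurable M"
      by (intro borel_measurable_sum H.random_variable)
    have "prob {\<omega> \<in> space M. a / 3 \<le> \<bar>\<Sum>i=1..k. Y i \<omega>\<bar>}
      \<le> prob {\<omega> \<in> space M. \<bar>(\<Sum>i=1..k. Y i \<omega>) - m\<bar> \<ge> a / 6}"
    proof (intro finite_measure_mono subsetI CollectI conjI; (elim CollectE conjE)?)
      fix \<omega> assume "a / 3 \<le> \<bar>\<Sum>i=1..k. Y i \<omega>\<bar>"
      with m show "a / 6 \<le> \<bar>(\<Sum>i=1..k. Y i \<omega>) - m\<bar>" by linarith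
    qed measurable
    also have "\<dots> \<le> 2 * exp (-2 * (a / 6)\<^sup>2 / (\<Sum>i\<in>{1..k}. (K - - K)\<^sup>2))"
      using a K False by (intro H.Hoeffding_ineq_abs_ge) auto
    also have "-2 * (a / 6)\<^sup>2 / (\<Sum>i\<in>{1..k}. (K - - K)\<^sup>2) = - (a\<^sup>2 / (72 * real k * K\<^sup>2))"
      using False K by (simp add: field_simps power2_eq_square)
    also have "2 * exp (- (a\<^sup>2 / (72 * real k * K\<^sup>2))) \<le> 2 * exp (- (a\<^sup>2 / (72 * real l * K\<^sup>2)))"
      using False K k by (auto intro!: divide_left_mono mult_right_mono mult_pos_pos)
    finally show ?thesis .
  qed
  from Etemadi_inequality[OF indepY _ this] a show ?thesis by (simp add: Y_def)
qed

end

section \<open>Central limit theorem for rows and for vectors of independent components\<close>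

text \<open>
  Compare \<open>a r\<close> with \<open>exp (z / n r)\<close>.  Both lie in the unit disc, so that their powers of order \<open>l r\<close>
  differ by at most \<open>l r\<close> times their distance, which is of smaller order than \<open>1 / n r\<close>.  Working with
  \<open>exp (z / n r)\<close> avoids complex logarithms.
\<close>

lemma tendsto_power_exp:
  fixes a :: "nat \<Rightarrow> complex" and n l :: "nat \<Rightarrow> nat"
  assumes a: "\<And>r. norm (a r) \<le> 1" and n: "filterlim n at_top sequentially"
    and lim: "(\<lambda>r. of_nat (n r) * (a r - 1)) \<longlonglongrightarrow> z" and "Re z \<le> 0"
    and l: "(\<lambda>r. real (l r) / real (n r)) \<longlonglongrightarrow> D"
  shows "(\<lambda>r. a r ^ l r) \<longlonglongrightarrow> exp (of_real D * z)"
proof -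
  define b where "b r = exp (z / of_nat (n r))" for r
  have b: "norm (b r) \<le> 1" for r
    using \<open>Re z \<le> 0\<close> by (simp add: b_def Re_divide_of_nat divide_nonpos_nonneg)
  have n0: "\<forall>\<^sub>F r in sequentially. 0 < n r" using n[unfolded filterlim_at_top, rule_format, of 1] by eventually_elim simp
  have "((\<lambda>h. exp (h * z)) has_field_derivative z) (at 0)"
    by (auto intro!: derivative_eq_intros)
  then have "((\<lambda>h. (exp (h * z) - 1) / h) \<longlongrightarrow> z) (at 0)" by (simp add: DERIV_def)
  moreover have "filterlim (\<lambda>r. inverse (of_nat (n r)) :: complex) (at 0) sequentially"
    unfolding filterlim_at
  proof
    show "\<forall>\<^sub>F r in sequentially. inverse (of_nat (n r)) \<in> UNIV \<and> inverse (of_nat (n r)) \<noteq> (0::complex)"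
      using n0 by eventually_elim simp
    show "(\<lambda>r. inverse (of_nat (n r)) :: complex) \<longlonglongrightarrow> 0"
      by (rule filterlim_compose[OF lim_inverse_n n])
  qed
  ultimately have "(\<lambda>r. (exp (inverse (of_nat (n r)) * z) - 1) / inverse (of_nat (n r))) \<longlonglongrightarrow> z"
    by (rule filterlim_compose)
  then have "(\<lambda>r. of_nat (n r) * (b r - 1)) \<longlonglongrightarrow> z"
    by (simp add: b_def field_simps)
  from tendsto_norm[OF tendsto_diff[OF lim this]]
  have "(\<lambda>r. norm (of_nat (n r) * (a r - 1) - of_nat (n r) * (b r - 1))) \<longlonglongrightarrow> 0" by simp
  from tendsto_mult[OF l this]
  have "(\<lambda>r. real (l r) / real (n r) * norm (of_nat (n r) * (a r - 1) - of_nat (n r) * (b r - 1))) \<longlonglongrightarrow> 0"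
    by simp
  then have "(\<lambda>r. a r ^ l r - b r ^ l r) \<longlonglongrightarrow> 0"
  proof (rule Lim_null_comparison[rotated])
    show "\<forall>\<^sub>F r in sequentially. norm (a r ^ l r - b r ^ l r)
      \<le> real (l r) / real (n r) * norm (of_nat (n r) * (a r - 1) - of_nat (n r) * (b r - 1))"
      using n0
    proof eventually_elim
      case (elim r)
      have "of_nat (n r) * (a r - 1) - of_nat (n r) * (b r - 1) = of_nat (n r) * (a r - b r)"
        by (simp add: algebra_simps)
      then show ?case using norm_power_diff[OF a[of r] b[of r], of "l r"] elim by (simp add: norm_mult)
    qed
  qed
  moreover have "(\<lambda>r. exp (of_real (real (l r) / real (n r)) * z)) \<longlonglongrightarrow> exp (of_real D * z)"
    by (intro tendsto_intros l)
  moreover have "exp (of_real (real (l r) / real (n r)) * z) = b r ^ l r" for r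
    by (simp add: b_def exp_of_nat_mult[symmetric])
  ultimately show ?thesis using tendsto_add by fastforce
qed

lemma (in real_distribution) integrable_power_of_bounded:
  assumes "AE x in M. \<bar>x\<bar> \<le> K"
  shows "integrable M (\<lambda>x. x ^ k)"
proof (rule integrable_const_bound[where B="K ^ k"])
  show "AE x in M. norm (x ^ k) \<le> K ^ k"
    using assms by eventually_elim (auto simp: power_abs intro: power_mono)
qed simp

lemma (in real_distribution) char_approx_bounded:
  assumes K: "AE x in M. \<bar>x\<bar> \<le> K"
  shows "norm (char M t - (1 + \<i> * t * expectation (\<lambda>x. x) - t\<^sup>2 * expectation (\<lambda>x. x\<^sup>2) / 2))
    \<le> \<bar>t\<bar> ^ 3 * K ^ 3 / 6"
proof -
  have "expectation (\<lambda>x. min (2 * \<bar>x\<bar> ^ 2 * Suc 2) (\<bar>t\<bar> * \<bar>x\<bar> ^ Suc 2)) \<le> expectation (\<lambda>x. \<bar>t\<bar> * K ^ 3)"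
  proof (rule integral_mono_AE)
    show "integrable M (\<lambda>x. min (2 * \<bar>x\<bar> ^ 2 * Suc 2) (\<bar>t\<bar> * \<bar>x\<bar> ^ Suc 2))"
      by (rule Bochner_Integration.integrable_bound[where f="\<lambda>x. 6 * x ^ 2"])
         (auto intro!: integrable_power_of_bounded[OF K] simp: min_def)
    show "AE x in M. min (2 * \<bar>x\<bar> ^ 2 * Suc 2) (\<bar>t\<bar> * \<bar>x\<bar> ^ Suc 2) \<le> \<bar>t\<bar> * K ^ 3"
      using K
    proof eventually_elim
      case (elim x)
      then have "\<bar>t\<bar> * \<bar>x\<bar> ^ Suc 2 \<le> \<bar>t\<bar> * K ^ 3"
        by (intro mult_left_mono) (auto intro: power_mono simp del: power_Suc simp: eval_nat_numeral)
      then show ?case by linarith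
    qed
  qed simp
  also have "\<dots> = \<bar>t\<bar> * K ^ 3" using prob_space by simp
  finally have *: "(\<bar>t\<bar> ^ 2 / fact (Suc 2)) * expectation (\<lambda>x. min (2 * \<bar>x\<bar> ^ 2 * Suc 2) (\<bar>t\<bar> * \<bar>x\<bar> ^ Suc 2))
    \<le> (\<bar>t\<bar> ^ 2 / fact (Suc 2)) * (\<bar>t\<bar> * K ^ 3)"
    by (intro mult_left_mono) auto
  have sum2: "(\<Sum>k\<le>2. f k) = f 0 + f 1 + f 2" for f :: "nat \<Rightarrow> complex"
    by (simp add: eval_nat_numeral)
  have "(\<Sum>k\<le>2. ((\<i> * t)^k / fact k) * expectation (\<lambda>x. x^k))
      = 1 + \<i> * t * expectation (\<lambda>x. x) - t\<^sup>2 * expectation (\<lambda>x. x\<^sup>2) / 2"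
    using prob_space by (simp add: sum2 power_mult_distrib)
  with order_trans[OF char_approx2[of 2 t, OF integrable_power_of_bounded[OF K]] *] show ?thesis
    by (simp add: fact_numeral power2_eq_square power3_eq_cube)
qed

text \<open>
  The second-order expansion of the characteristic function at \<open>t / \<surd>n\<close> is \<open>1 + z / n\<close> up to an error of
  order \<open>n\<close> to the power \<open>-3/2\<close>, as third moments are bounded.
\<close>

lemma char_power_tendsto:
  fixes \<nu> :: "nat \<Rightarrow> real measure" and n l :: "nat \<Rightarrow> nat"
  assumes \<nu>: "\<And>r. real_distribution (\<nu> r)" and K: "\<And>r. AE x in \<nu> r. \<bar>x\<bar> \<le> K"
    and n: "filterlim n at_top sequentially"
    and mean: "(\<lambda>r. sqrt (real (n r)) * (LINT x|\<nu> r. x)) \<longlonglongrightarrow> b"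
    and var: "(\<lambda>r. LINT x|\<nu> r. x\<^sup>2) \<longlonglongrightarrow> v"
    and l: "(\<lambda>r. real (l r) / real (n r)) \<longlonglongrightarrow> D"
  shows "(\<lambda>r. char (\<nu> r) (t / sqrt (real (n r))) ^ l r) \<longlonglongrightarrow> exp (of_real D * (\<i> * t * b - t\<^sup>2 * v / 2))"
proof (rule tendsto_power_exp[OF _ n _ _ l])
  show "norm (char (\<nu> r) (t / sqrt (real (n r)))) \<le> 1" for r
    using \<nu>[of r] by (rule real_distribution.cmod_char_le_1)
  have "v \<ge> 0" by (rule tendsto_lowerbound[OF var]) auto
  then show "Re (\<i> * t * b - t\<^sup>2 * v / 2) \<le> 0"
    by (simp add: Re_divide_numeral power2_eq_square mult_nonneg_nonneg)
  define R where "R r = char (\<nu> r) (t / sqrt (real (n r))) - (1 + \<i> * (t / sqrt (real (n r))) * (LINT x|\<nu> r. x)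
     - (t / sqrt (real (n r)))\<^sup>2 * (LINT x|\<nu> r. x\<^sup>2) / 2)" for r
  have n0: "\<forall>\<^sub>F r in sequentially. 0 < n r" using n[unfolded filterlim_at_top, rule_format, of 1] by eventually_elim simp
  have sq: "filterlim (\<lambda>r. sqrt (real (n r))) at_top sequentially"
    by (intro filterlim_compose[OF sqrt_at_top] filterlim_compose[OF filterlim_real_sequentially] n)
  have "(\<lambda>r. \<bar>t\<bar> ^ 3 * K ^ 3 / 6 / sqrt (real (n r))) \<longlonglongrightarrow> 0"
    by (rule tendsto_divide_0[OF tendsto_const filterlim_at_top_imp_at_infinity[OF sq]])
  then have R: "(\<lambda>r. of_nat (n r) * R r) \<longlonglongrightarrow> 0"
  proof (rule Lim_null_comparison[rotated])
    show "\<forall>\<^sub>F r in sequentially. norm (of_nat (n r) * R r) \<le> \<bar>t\<bar> ^ 3 * K ^ 3 / 6 / sqrt (real (n r))"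
      using n0
    proof eventually_elim
      case (elim r)
      have "norm (of_nat (n r) * R r) \<le> real (n r) * (\<bar>t / sqrt (real (n r))\<bar> ^ 3 * K ^ 3 / 6)"
        unfolding norm_mult R_def
        using real_distribution.char_approx_bounded[OF \<nu> K, of r "t / sqrt (real (n r))"]
        by (intro mult_mono) simp_all
      also have "\<dots> = \<bar>t\<bar> ^ 3 * K ^ 3 / 6 / sqrt (real (n r))"
        using elim by (simp add: field_simps power3_eq_cube)
      finally show ?case .
    qed
  qed
  have "(\<lambda>r. \<i> * t * of_real (sqrt (real (n r)) * (LINT x|\<nu> r. x)) - of_real (t\<^sup>2 * (LINT x|\<nu> r. x\<^sup>2) / 2)
      + of_nat (n r) * R r) \<longlonglongrightarrow> \<i> * t * b - t\<^sup>2 * v / 2 + 0"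
    by (intro tendsto_intros mean var R) auto
  then have lim: "(\<lambda>r. \<i> * t * of_real (sqrt (real (n r)) * (LINT x|\<nu> r. x)) - of_real (t\<^sup>2 * (LINT x|\<nu> r. x\<^sup>2) / 2)
      + of_nat (n r) * R r) \<longlonglongrightarrow> \<i> * t * b - t\<^sup>2 * v / 2" by simp
  show "(\<lambda>r. of_nat (n r) * (char (\<nu> r) (t / sqrt (real (n r))) - 1)) \<longlonglongrightarrow> \<i> * t * b - t\<^sup>2 * v / 2"
  proof (rule Lim_transform_eventually[OF lim])
    show "\<forall>\<^sub>F r in sequentially. \<i> * t * of_real (sqrt (real (n r)) * (LINT x|\<nu> r. x))
        - of_real (t\<^sup>2 * (LINT x|\<nu> r. x\<^sup>2) / 2) + of_nat (n r) * R r
      = of_nat (n r) * (char (\<nu> r) (t / sqrt (real (n r))) - 1)"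
      using n0
    proof eventually_elim
      case (elim r)
      have s2: "sqrt (real (n r)) * sqrt (real (n r)) = real (n r)" by simp
      have "of_nat (n r) = complex_of_real (sqrt (real (n r))) * complex_of_real (sqrt (real (n r)))"
        unfolding of_real_mult[symmetric] s2 by simp
      moreover have "complex_of_real (sqrt (real (n r))) \<noteq> 0" using elim by simp
      ultimately show ?case by (simp add: R_def field_simps power2_eq_square)
    qed
  qed
qed

text \<open>
  A central limit theorem for rows of identically distributed bounded variables whose means are of
  order \<open>1 / \<surd>n\<close>, so that they contribute a drift; the number of summands need only be asymptotic to
  \<open>D\<close> times the scale \<open>n\<close>.
\<close>

theorem bounded_rows_central_limit:
  fixes M :: "nat \<Rightarrow> 'a measure" and X :: "nat \<Rightarrow> 'i \<Rightarrow> 'a \<Rightarrow> real" and n :: "nat \<Rightarrow> nat"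
  assumes \<nu>: "\<And>r. real_distribution (\<nu> r)" and K: "\<And>r. AE x in \<nu> r. \<bar>x\<bar> \<le> K"
    and n: "filterlim n at_top sequentially"
    and mean: "(\<lambda>r. sqrt (real (n r)) * (LINT x|\<nu> r. x)) \<longlonglongrightarrow> b"
    and var: "(\<lambda>r. LINT x|\<nu> r. x\<^sup>2) \<longlonglongrightarrow> v"
    and prob: "\<And>r. prob_space (M r)"
    and indep: "\<And>r. prob_space.indep_vars (M r) (\<lambda>_. borel) (X r) (I r)"
    and law: "\<And>r i. i \<in> I r \<Longrightarrow> distr (M r) borel (X r i) = \<nu> r"
    and l: "(\<lambda>r. real (card (I r)) / real (n r)) \<longlonglongrightarrow> D"
    and N: "real_distribution N" and char_N: "\<And>t. char N t = exp (of_real D * (\<i> * t * b - t\<^sup>2 * v / 2))"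
  shows "weak_conv_m (\<lambda>r. distr (M r) borel (\<lambda>\<omega>. 1 / sqrt (real (n r)) * (\<Sum>i\<in>I r. X r i \<omega>))) N"
proof (rule levy_continuity[OF _ N])
  interpret M: prob_space "M r" for r by (rule prob)
  have X: "X r i \<in> borel_measurable (M r)" if "i \<in> I r" for r i
    using indep[of r] that unfolding M.indep_vars_def by auto
  have S: "(\<lambda>\<omega>. \<Sum>i\<in>I r. X r i \<omega>) \<in> borel_measurable (M r)" for r
    by (intro borel_measurable_sum X)
  show "real_distribution (distr (M r) borel (\<lambda>\<omega>. 1 / sqrt (real (n r)) * (\<Sum>i\<in>I r. X r i \<omega>)))" for r
    by (intro M.real_distribution_distr borel_measurable_times borel_measurable_const S)
  show "(\<lambda>r. char (distr (M r) borel (\<lambda>\<omega>. 1 / sqrt (real (n r)) * (\<Sum>i\<in>I r. X r i \<omega>))) t) \<longlonglongrightarrow> char N t" for t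
  proof -
    have scale: "char (distr (M r) borel (\<lambda>\<omega>. 1 / sqrt (real (n r)) * (\<Sum>i\<in>I r. X r i \<omega>))) t
        = char (distr (M r) borel (\<lambda>\<omega>. \<Sum>i\<in>I r. X r i \<omega>)) (t / sqrt (real (n r)))" for r
      using S[of r] by (simp add: char_def integral_distr)
    have "char (distr (M r) borel (\<lambda>\<omega>. 1 / sqrt (real (n r)) * (\<Sum>i\<in>I r. X r i \<omega>))) t
        = char (\<nu> r) (t / sqrt (real (n r))) ^ card (I r)" for r
      unfolding scale by (simp add: M.char_distr_sum[OF indep] law)
    then show ?thesis using char_power_tendsto[OF \<nu> K n mean var l, of t] by (simp add: char_N)
  qed
qed

lemma distr_PiM_componentwise:
  assumes I: "finite I" and M: "\<And>i. i \<in> I \<Longrightarrow> prob_space (M i)"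
    and f: "\<And>i. i \<in> I \<Longrightarrow> f i \<in> measurable (M i) (N i)"
  shows "distr (PiM I M) (PiM I N) (\<lambda>\<omega>. \<lambda>i\<in>I. f i (\<omega> i)) = PiM I (\<lambda>i. distr (M i) (N i) (f i))"
proof -
  define M' where "M' i = (if i \<in> I then M i else return (count_space UNIV) undefined)" for i
  define D where "D i = (if i \<in> I then distr (M i) (N i) (f i) else return (count_space UNIV) undefined)" for i
  interpret M': product_prob_space M' I
    by (intro product_prob_spaceI) (auto simp: M'_def M intro!: prob_space_return)
  interpret D: product_prob_space D I
    by (intro product_prob_spaceI)
       (auto simp: D_def intro!: prob_space_return prob_space.prob_space_distr M f)
  have eqs: "PiM I M' = PiM I M" "PiM I D = PiM I (\<lambda>i. distr (M i) (N i) (f i))"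
    by (auto intro!: PiM_cong simp: M'_def D_def)
  have meas: "(\<lambda>\<omega>. \<lambda>i\<in>I. f i (\<omega> i)) \<in> measurable (PiM I M) (PiM I N)"
    by (intro measurable_restrict) (rule measurable_compose[OF measurable_component_singleton], auto intro: f)
  have "distr (PiM I M) (PiM I N) (\<lambda>\<omega>. \<lambda>i\<in>I. f i (\<omega> i)) = PiM I D"
  proof (rule D.PiM_eqI[OF I])
    show "sets (distr (PiM I M) (PiM I N) (\<lambda>\<omega>. \<lambda>i\<in>I. f i (\<omega> i))) = sets (PiM I D)"
      by (auto intro!: sets_PiM_cong simp: D_def)
    fix A assume "\<And>i. i \<in> I \<Longrightarrow> A i \<in> sets (D i)"
    then have A: "A i \<in> sets (N i)" if "i \<in> I" for i using that by (auto simp: D_def)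
    have "emeasure (distr (PiM I M) (PiM I N) (\<lambda>\<omega>. \<lambda>i\<in>I. f i (\<omega> i))) (Pi\<^sub>E I A)
      = emeasure (PiM I M) ((\<lambda>\<omega>. \<lambda>i\<in>I. f i (\<omega> i)) -` Pi\<^sub>E I A \<inter> space (PiM I M))"
      using I A meas by (intro emeasure_distr sets_PiM_I_finite) auto
    also have "(\<lambda>\<omega>. \<lambda>i\<in>I. f i (\<omega> i)) -` Pi\<^sub>E I A \<inter> space (PiM I M) = (\<Pi>\<^sub>E i\<in>I. f i -` A i \<inter> space (M i))"
      by (auto simp: space_PiM PiE_iff)
    also have "emeasure (PiM I M) \<dots> = emeasure (PiM I M') \<dots>" by (simp add: eqs)
    also have "\<dots> = (\<Prod>i\<in>I. emeasure (M' i) (f i -` A i \<inter> space (M i)))"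
      using f A by (intro M'.emeasure_PiM[OF I]) (auto simp: M'_def)
    also have "\<dots> = (\<Prod>i\<in>I. emeasure (D i) (A i))"
      using f A by (intro prod.cong) (auto simp: M'_def D_def emeasure_distr)
    finally show "emeasure (distr (PiM I M) (PiM I N) (\<lambda>\<omega>. \<lambda>i\<in>I. f i (\<omega> i))) (Pi\<^sub>E I A)
      = (\<Prod>i\<in>I. emeasure (D i) (A i))" .
  qed
  then show ?thesis by (simp add: eqs)
qed

text \<open>
  Skorohod's theorem realizes the convergence of each component as pointwise convergence on some
  probability space; the product of these spaces realizes all of them together, with the joint laws
  that independence prescribes.  There the claim is dominated convergence.
\<close>

theorem weak_conv_independent_components:
  fixes M :: "nat \<Rightarrow> 'a measure" and \<xi> :: "nat \<Rightarrow> nat \<Rightarrow> 'a \<Rightarrow> real"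
    and P :: "'c measure" and \<zeta> :: "nat \<Rightarrow> 'c \<Rightarrow> real"
    and h :: "(nat \<Rightarrow> real) \<Rightarrow> real"
  assumes prob: "\<And>r. prob_space (M r)" "prob_space P"
    and indep: "\<And>r. prob_space.indep_vars (M r) (\<lambda>_. borel) (\<xi> r) {..<p}"
      "prob_space.indep_vars P (\<lambda>_. borel) \<zeta> {..<p}"
    and weak: "\<And>j. j < p \<Longrightarrow> weak_conv_m (\<lambda>r. distr (M r) borel (\<xi> r j)) (distr P borel (\<zeta> j))"
    and h: "h \<in> borel_measurable (PiM {..<p} (\<lambda>_. borel))" and bdd: "\<And>y. \<bar>h y\<bar> \<le> C"
    and cont: "\<And>u y. (\<And>j. j < p \<Longrightarrow> (\<lambda>r::nat. u r j) \<longlonglongrightarrow> y j) \<Longrightarrow> (\<lambda>r. h (u r)) \<longlonglongrightarrow> h y"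
  shows "(\<lambda>r. LINT \<omega>|M r. h (\<lambda>j\<in>{..<p}. \<xi> r j \<omega>)) \<longlonglongrightarrow> (LINT \<omega>|P. h (\<lambda>j\<in>{..<p}. \<zeta> j \<omega>))"
proof (cases "p = 0")
  interpret M: prob_space "M r" for r by (rule prob)
  interpret P: prob_space P by (rule prob)
  case True
  then show ?thesis by (simp add: restrict_def M.prob_space P.prob_space)
next
  interpret M: prob_space "M r" for r by (rule prob)
  interpret P: prob_space P by (rule prob)
  case False
  have \<xi>: "\<xi> r j \<in> borel_measurable (M r)" if "j < p" for r j
    using indep(1)[of r] that unfolding M.indep_vars_def by auto
  have \<zeta>: "\<zeta> j \<in> borel_measurable P" if "j < p" for j
    using indep(2) that unfolding P.indep_vars_def by auto
  define R where "R j w \<longleftrightarrow> (case w of (\<Omega> :: real measure, Y, Z) \<Rightarrow> prob_space \<Omega> \<and> (\<forall>r. Y r \<in> borel_measurable \<Omega>) \<and>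
    (\<forall>r. distr \<Omega> borel (Y r) = distr (M r) borel (\<xi> r j)) \<and> Z \<in> borel_measurable \<Omega> \<and>
    distr \<Omega> borel Z = distr P borel (\<zeta> j) \<and> (\<forall>x\<in>space \<Omega>. (\<lambda>r. Y r x) \<longlonglongrightarrow> Z x))" for j w
  have "\<exists>w. R j w" if "j < p" for j
  proof -
    have "real_distribution (distr (M r) borel (\<xi> r j))" for r
      using \<xi>[OF that] by (rule M.real_distribution_distr)
    moreover have "real_distribution (distr P borel (\<zeta> j))"
      using \<zeta>[OF that] by (rule P.real_distribution_distr)
    ultimately show ?thesis using Skorohod[OF _ _ weak[OF that]] by (simp add: R_def)
  qed
  then have "\<forall>j\<in>{..<p}. \<exists>w. R j w" by simp
  from bchoice[OF this] obtain w where w: "\<And>j. j < p \<Longrightarrow> R j (w j)" by auto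
  define \<Omega> where "\<Omega> j = fst (w j)" for j
  define Y where "Y j = fst (snd (w j))" for j
  define Z where "Z j = snd (snd (w j))" for j
  have R: "R j (\<Omega> j, Y j, Z j)" if "j < p" for j using w[OF that] by (simp add: \<Omega>_def Y_def Z_def)
  have \<Omega>: "prob_space (\<Omega> j)" and Y: "Y j r \<in> borel_measurable (\<Omega> j)"
    and Z: "Z j \<in> borel_measurable (\<Omega> j)"
    and dY: "distr (\<Omega> j) borel (Y j r) = distr (M r) borel (\<xi> r j)"
    and dZ: "distr (\<Omega> j) borel (Z j) = distr P borel (\<zeta> j)"
    and YZ: "x \<in> space (\<Omega> j) \<Longrightarrow> (\<lambda>r. Y j r x) \<longlonglongrightarrow> Z j x" if "j < p" for j r x
    using R[OF that] by (auto simp: R_def)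
  define W where "W = PiM {..<p} \<Omega>"
  interpret W: prob_space W unfolding W_def by (rule prob_space_PiM) (auto intro: \<Omega>)
  have wY: "(\<lambda>\<omega>. \<lambda>j\<in>{..<p}. Y j r (\<omega> j)) \<in> measurable W (PiM {..<p} (\<lambda>_. borel))" for r
    unfolding W_def by (intro measurable_restrict) (rule measurable_compose[OF measurable_component_singleton], auto intro: Y)
  have wZ: "(\<lambda>\<omega>. \<lambda>j\<in>{..<p}. Z j (\<omega> j)) \<in> measurable W (PiM {..<p} (\<lambda>_. borel))"
    unfolding W_def by (intro measurable_restrict) (rule measurable_compose[OF measurable_component_singleton], auto intro: Z)
  have EY: "(LINT \<omega>|M r. h (\<lambda>j\<in>{..<p}. \<xi> r j \<omega>)) = (LINT \<omega>|W. h (\<lambda>j\<in>{..<p}. Y j r (\<omega> j)))" for r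
  proof -
    have "distr (M r) (PiM {..<p} (\<lambda>_. borel)) (\<lambda>\<omega>. \<lambda>j\<in>{..<p}. \<xi> r j \<omega>)
      = PiM {..<p} (\<lambda>j. distr (M r) borel (\<xi> r j))"
      using False indep(1) \<xi> by (subst M.indep_vars_iff_distr_eq_PiM'[symmetric]) auto
    also have "\<dots> = PiM {..<p} (\<lambda>j. distr (\<Omega> j) borel (Y j r))" by (intro PiM_cong) (auto simp: dY)
    also have "\<dots> = distr W (PiM {..<p} (\<lambda>_. borel)) (\<lambda>\<omega>. \<lambda>j\<in>{..<p}. Y j r (\<omega> j))"
      unfolding W_def by (rule distr_PiM_componentwise[symmetric]) (auto intro: \<Omega> Y)
    finally have eq: "distr (M r) (PiM {..<p} (\<lambda>_. borel)) (\<lambda>\<omega>. \<lambda>j\<in>{..<p}. \<xi> r j \<omega>)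
      = distr W (PiM {..<p} (\<lambda>_. borel)) (\<lambda>\<omega>. \<lambda>j\<in>{..<p}. Y j r (\<omega> j))" .
    have m\<xi>: "(\<lambda>\<omega>. \<lambda>j\<in>{..<p}. \<xi> r j \<omega>) \<in> measurable (M r) (PiM {..<p} (\<lambda>_. borel))"
      by (intro measurable_restrict \<xi>) auto
    show ?thesis
      using integral_distr[OF m\<xi> h] integral_distr[OF wY[of r] h] eq by simp
  qed
  have EZ: "(LINT \<omega>|P. h (\<lambda>j\<in>{..<p}. \<zeta> j \<omega>)) = (LINT \<omega>|W. h (\<lambda>j\<in>{..<p}. Z j (\<omega> j)))"
  proof -
    have "distr P (PiM {..<p} (\<lambda>_. borel)) (\<lambda>\<omega>. \<lambda>j\<in>{..<p}. \<zeta> j \<omega>)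
      = PiM {..<p} (\<lambda>j. distr P borel (\<zeta> j))"
      using False indep(2) \<zeta> by (subst P.indep_vars_iff_distr_eq_PiM'[symmetric]) auto
    also have "\<dots> = PiM {..<p} (\<lambda>j. distr (\<Omega> j) borel (Z j))" by (intro PiM_cong) (auto simp: dZ)
    also have "\<dots> = distr W (PiM {..<p} (\<lambda>_. borel)) (\<lambda>\<omega>. \<lambda>j\<in>{..<p}. Z j (\<omega> j))"
      unfolding W_def by (rule distr_PiM_componentwise[symmetric]) (auto intro: \<Omega> Z)
    finally have eq: "distr P (PiM {..<p} (\<lambda>_. borel)) (\<lambda>\<omega>. \<lambda>j\<in>{..<p}. \<zeta> j \<omega>)
      = distr W (PiM {..<p} (\<lambda>_. borel)) (\<lambda>\<omega>. \<lambda>j\<in>{..<p}. Z j (\<omega> j))" .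
    have m\<zeta>: "(\<lambda>\<omega>. \<lambda>j\<in>{..<p}. \<zeta> j \<omega>) \<in> measurable P (PiM {..<p} (\<lambda>_. borel))"
      by (intro measurable_restrict \<zeta>) auto
    show ?thesis
      using integral_distr[OF m\<zeta> h] integral_distr[OF wZ h] eq by simp
  qed
  show ?thesis
    unfolding EY EZ
  proof (rule integral_dominated_convergence[where w="\<lambda>_. C"])
    show "AE \<omega> in W. (\<lambda>r. h (\<lambda>j\<in>{..<p}. Y j r (\<omega> j))) \<longlonglongrightarrow> h (\<lambda>j\<in>{..<p}. Z j (\<omega> j))"
    proof (rule AE_I2, rule cont)
      fix \<omega> j assume "\<omega> \<in> space W" "j < p"
      then show "(\<lambda>r. (\<lambda>j\<in>{..<p}. Y j r (\<omega> j)) j) \<longlonglongrightarrow> (\<lambda>j\<in>{..<p}. Z j (\<omega> j)) j"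
        using YZ[of j "\<omega> j"] by (auto simp: W_def space_PiM)
    qed
    show "(\<lambda>\<omega>. h (\<lambda>j\<in>{..<p}. Z j (\<omega> j))) \<in> borel_measurable W"
      by (rule measurable_compose[OF wZ h])
    show "(\<lambda>\<omega>. h (\<lambda>j\<in>{..<p}. Y j r (\<omega> j))) \<in> borel_measurable W" for r
      by (rule measurable_compose[OF wY h])
  qed (simp_all add: bdd)
qed

section \<open>Invariance principle for bounded rows with drift\<close>

lemma char_brownian_increment:
  assumes P: "prob_space P" and st: "s < t"
    and D: "distributed P lborel (\<lambda>\<omega>. B t \<omega> - B s \<omega>) (\<lambda>x. ennreal (normal_density 0 (sqrt (t - s)) x))"
  shows "char (distr P borel (\<lambda>\<omega>. \<sigma> * (B t \<omega> - B s \<omega>) + b * (t - s))) u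
    = exp (of_real (t - s) * (\<i> * u * b - u\<^sup>2 * \<sigma>\<^sup>2 / 2))"
proof -
  interpret prob_space P by (rule P)
  define a where "a = sqrt (t - s)"
  have a: "a > 0" "a * a = t - s" using st by (simp_all add: a_def)
  define \<xi> where "\<xi> \<omega> = (B t \<omega> - B s \<omega>) / a" for \<omega>
  have dist: "distributed P lborel \<xi> std_normal_density"
    using D normal_standard_normal_convert[OF a(1), of "\<lambda>\<omega>. B t \<omega> - B s \<omega>" 0]
    by (simp add: \<xi>_def[abs_def] a_def)
  then have \<xi>: "\<xi> \<in> borel_measurable P" using distributed_measurable by force
  have "distr P borel \<xi> = distr P lborel \<xi>" by (rule distr_cong) auto
  then have law: "distr P borel \<xi> = std_normal_distribution"
    using distributed_distr_eq_density[OF dist] by simp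
  have "B t \<omega> - B s \<omega> = a * \<xi> \<omega>" for \<omega> using a(1) by (simp add: \<xi>_def)
  then have "char (distr P borel (\<lambda>\<omega>. \<sigma> * (B t \<omega> - B s \<omega>) + b * (t - s))) u
      = (CLINT \<omega>|P. iexp (u * b * (t - s)) * iexp (u * \<sigma> * a * \<xi> \<omega>))"
    using \<xi> by (simp add: char_def integral_distr exp_add[symmetric] algebra_simps)
  also have "\<dots> = iexp (u * b * (t - s)) * char (distr P borel \<xi>) (u * \<sigma> * a)"
    using \<xi> by (simp add: char_def integral_distr)
  also have "\<dots> = iexp (u * b * (t - s)) * complex_of_real (exp (- ((u * \<sigma> * a)\<^sup>2) / 2))"
    unfolding law by (simp add: char_std_normal_distribution)
  also have "(u * \<sigma> * a)\<^sup>2 = u\<^sup>2 * \<sigma>\<^sup>2 * (t - s)"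
    unfolding a(2)[symmetric] by (simp add: power2_eq_square mult_ac)
  also have "iexp (u * b * (t - s)) * complex_of_real (exp (- (u\<^sup>2 * \<sigma>\<^sup>2 * (t - s)) / 2))
      = exp (of_real (t - s) * (\<i> * u * b - u\<^sup>2 * \<sigma>\<^sup>2 / 2))"
    by (simp add: exp_of_real[symmetric] exp_add[symmetric] algebra_simps add_divide_distrib diff_divide_distrib del: exp_of_real)
  finally show ?thesis .
qed

text \<open>
  The inverse of taking increments along the grid: it exhibits a functional of a grid path as a
  continuous function of finitely many increments.
\<close>

definition path_of_increments :: "nat \<Rightarrow> (nat \<Rightarrow> real) \<Rightarrow> real \<Rightarrow> real" where
  "path_of_increments q y = step_path q (\<lambda>j. \<Sum>i<min j (q * q). y i)"

lemma path_of_increments_in_cadlag: "path_of_increments q y \<in> cadlag"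
  by (simp add: path_of_increments_def step_path_in_cadlag)

lemma grid_path_eq_path_of_increments:
  assumes "x 0 = 0"
  shows "grid_path q x = path_of_increments q (\<lambda>i\<in>{..<q * q}. x (real (Suc i) / real q) - x (real i / real q))"
proof -
  have "(\<Sum>i<min j (q * q). (\<lambda>i\<in>{..<q * q}. x (real (Suc i) / real q) - x (real i / real q)) i)
    = (\<Sum>i<min j (q * q). x (real (Suc i) / real q) - x (real i / real q))" for j
    by (intro sum.cong) auto
  also have "\<dots> j = x (real (min j (q * q)) / real q)" for j
    using assms by (subst sum_lessThan_telescope) simp
  finally show ?thesis by (simp add: grid_path_def path_of_increments_def)
qed

lemma nat_floor_lim:
  fixes n :: "nat \<Rightarrow> nat"
  assumes n: "filterlim n at_top sequentially" and "a \<ge> 0"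
  shows "(\<lambda>r. real (nat \<lfloor>real (n r) * a\<rfloor>) / real (n r)) \<longlonglongrightarrow> a"
proof -
  have n0: "\<forall>\<^sub>F r in sequentially. 0 < n r"
    using n[unfolded filterlim_at_top, rule_format, of 1] by eventually_elim simp
  have "(\<lambda>r. 1 / real (n r)) \<longlonglongrightarrow> 0"
    by (rule tendsto_divide_0[OF tendsto_const])
       (intro filterlim_at_top_imp_at_infinity filterlim_compose[OF filterlim_real_sequentially n])
  then have "(\<lambda>r. real (nat \<lfloor>real (n r) * a\<rfloor>) / real (n r) - a) \<longlonglongrightarrow> 0"
  proof (rule Lim_null_comparison[rotated])
    show "\<forall>\<^sub>F r in sequentially. norm (real (nat \<lfloor>real (n r) * a\<rfloor>) / real (n r) - a) \<le> 1 / real (n r)"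
      using n0
    proof eventually_elim
      case (elim r)
      have "real (nat \<lfloor>real (n r) * a\<rfloor>) = of_int \<lfloor>real (n r) * a\<rfloor>" using \<open>a \<ge> 0\<close> by simp
      then have "\<bar>real (nat \<lfloor>real (n r) * a\<rfloor>) - real (n r) * a\<bar> \<le> 1" by linarith
      moreover have "real (nat \<lfloor>real (n r) * a\<rfloor>) / real (n r) - a
          = (real (nat \<lfloor>real (n r) * a\<rfloor>) - real (n r) * a) / real (n r)"
        using elim by (simp add: field_simps)
      ultimately show ?case by (simp add: abs_divide divide_right_mono)
    qed
  qed
  then show ?thesis by (simp add: LIM_zero_iff)
qed

definition rescaled_walk :: "nat \<Rightarrow> (nat \<Rightarrow> real) \<Rightarrow> real \<Rightarrow> real" where
  "rescaled_walk n x = (\<lambda>t\<in>{0..}. 1 / sqrt (real n) * (\<Sum>i=1..nat \<lfloor>real n * t\<rfloor>. x i))"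

lemma rescaled_walk_eq_step_path:
  "rescaled_walk n x = step_path n (\<lambda>k. 1 / sqrt (real n) * (\<Sum>i=1..k. x i))"
  by (simp add: rescaled_walk_def step_path_def)

lemma rescaled_walk_in_cadlag: "rescaled_walk n x \<in> cadlag"
  by (simp add: rescaled_walk_eq_step_path step_path_in_cadlag)

lemma rescaled_walk_0 [simp]: "rescaled_walk n x 0 = 0"
  by (simp add: rescaled_walk_def)

lemma rescaled_walk_diff:
  assumes "0 \<le> s" "s \<le> t"
  shows "rescaled_walk n x t - rescaled_walk n x s
    = 1 / sqrt (real n) * (\<Sum>i\<in>{nat \<lfloor>real n * s\<rfloor><..nat \<lfloor>real n * t\<rfloor>}. x i)"
proof -
  define k l where "k = nat \<lfloor>real n * s\<rfloor>" and "l = nat \<lfloor>real n * t\<rfloor>"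
  have "k \<le> l" unfolding k_def l_def using assms by (intro nat_mono floor_mono mult_left_mono) auto
  then have "{1..l} = {1..k} \<union> {k<..l}" by auto
  then have "(\<Sum>i=1..l. x i) = (\<Sum>i=1..k. x i) + (\<Sum>i\<in>{k<..l}. x i)"
    by (simp add: sum.union_disjoint ivl_disj_int)
  then show ?thesis using assms by (simp add: rescaled_walk_def k_def l_def add_divide_distrib)
qed

text \<open>
  The walk takes at most \<open>n / q + 1 \<le> 2 n / q\<close> steps between two neighbouring grid times, so that its
  movement there is controlled by the first \<open>l\<close> partial sums after the grid time.
\<close>

lemma lu_dist_rescaled_walk_grid_path:
  fixes q n l :: nat and x :: "nat \<Rightarrow> real"
  defines "L \<equiv> \<lambda>j. nat \<lfloor>real n * (real j / real q)\<rfloor>"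
  assumes "q \<ge> 1" "q \<le> n" and e: "1 / (1 + real q) \<le> e"
    and l: "2 * real n / real q < real l + 1"
    and osc: "\<And>j k. j < q * q \<Longrightarrow> k \<le> l \<Longrightarrow> \<bar>\<Sum>i=1..k. x (L j + i)\<bar> \<le> e * sqrt (real n)"
  shows "lu_dist (rescaled_walk n x) (grid_path q (rescaled_walk n x)) \<le> e"
proof (rule lu_dist_leI[OF e])
  fix t :: real assume t: "0 \<le> t" "t < real q"
  define j where "j = nat \<lfloor>real q * t\<rfloor>"
  define s where "s = real j / real q"
  have j: "j < q * q" and grid: "grid_path q (rescaled_walk n x) t = rescaled_walk n x s"
    using grid_path_eq[OF t] by (simp_all add: j_def s_def)
  have "real j = of_int \<lfloor>real q * t\<rfloor>" using t by (simp add: j_def)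
  then have "real j \<le> real q * t" "real q * t < real j + 1" by linarith+
  then have s: "0 \<le> s" "s \<le> t" "t < s + 1 / real q"
    using \<open>q \<ge> 1\<close> by (simp_all add: s_def field_simps)
  define k where "k = nat \<lfloor>real n * t\<rfloor> - L j"
  have Lj: "L j \<le> nat \<lfloor>real n * t\<rfloor>"
    unfolding L_def s_def[symmetric] using s by (intro nat_mono floor_mono mult_left_mono) auto
  have "real n * t \<le> real n * (s + 1 / real q)" using s by (intro mult_left_mono) auto
  then have "real n * t \<le> real n * s + real n / real q" by (simp add: distrib_left)
  moreover have floor_bounds: "real (nat \<lfloor>y\<rfloor>) \<le> y \<and> y < real (nat \<lfloor>y\<rfloor>) + 1" if "y \<ge> 0" for y :: real
    using that by linarith
  moreover have "1 \<le> real n / real q" using \<open>q \<ge> 1\<close> \<open>q \<le> n\<close> by simp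
  moreover have "real (nat \<lfloor>real n * t\<rfloor>) \<le> real n * t" "real n * s < real (L j) + 1"
    using floor_bounds[of "real n * t"] floor_bounds[of "real n * s"] t s
    unfolding L_def s_def[symmetric] by simp_all
  ultimately have "real k < real l + 1"
    using l Lj by (simp add: k_def of_nat_diff)
  then have "k \<le> l" by linarith
  have "{L j<..nat \<lfloor>real n * t\<rfloor>} = (\<lambda>i. L j + i) ` {1..k}"
    using Lj by (auto simp: k_def image_iff intro!: bexI[of _ "_ - L j"])
  then have "(\<Sum>i\<in>{L j<..nat \<lfloor>real n * t\<rfloor>}. x i) = sum x ((\<lambda>i. L j + i) ` {1..k})"
    by (simp only:)
  also have "\<dots> = (\<Sum>i=1..k. x (L j + i))"
    by (subst sum.reindex) auto
  finally have "(\<Sum>i\<in>{L j<..nat \<lfloor>real n * t\<rfloor>}. x i) = (\<Sum>i=1..k. x (L j + i))" .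
  then have "rescaled_walk n x t - rescaled_walk n x s = 1 / sqrt (real n) * (\<Sum>i=1..k. x (L j + i))"
    using rescaled_walk_diff[OF s(1,2), of n x] by (simp add: L_def s_def)
  moreover have "\<bar>1 / sqrt (real n) * (\<Sum>i=1..k. x (L j + i))\<bar> \<le> e"
    using osc[OF j \<open>k \<le> l\<close>] \<open>q \<ge> 1\<close> \<open>q \<le> n\<close> by (simp add: abs_mult field_simps)
  ultimately show "\<bar>rescaled_walk n x t - grid_path q (rescaled_walk n x) t\<bar> \<le> e" by (simp add: grid)
qed simp

text \<open>
  Outside an event of small probability the walk stays within \<open>e\<close> of its grid path, where \<open>G\<close> changes by
  at most \<open>L * e\<close>; on that event \<open>G\<close> changes by at most \<open>2 * C\<close>.  The bound does not contain \<open>n\<close>, so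
  that \<open>q\<close> can be chosen before \<open>n\<close> tends to infinity.
\<close>

lemma (in prob_space) lipschitz_rescaled_walk_grid_path:
  fixes X :: "nat \<Rightarrow> 'a \<Rightarrow> real"
  assumes indep: "indep_vars (\<lambda>_. borel) X {1..}" and K: "K > 0"
    and bdd: "\<And>i. i \<ge> 1 \<Longrightarrow> AE \<omega> in M. \<bar>X i \<omega>\<bar> \<le> K"
    and mean: "\<And>i. i \<ge> 1 \<Longrightarrow> sqrt (real n) * \<bar>expectation (X i)\<bar> \<le> d"
    and q: "q \<ge> 1" "q \<le> n" "1 / (1 + real q) \<le> e" "2 * d / real q \<le> e / 6"
    and G: "bdd_lipschitz G" and C: "\<And>x. x \<in> cadlag \<Longrightarrow> \<bar>G x\<bar> \<le> C"
    and L: "\<And>x y. x \<in> cadlag \<Longrightarrow> y \<in> cadlag \<Longrightarrow> \<bar>G x - G y\<bar> \<le> L * lu_dist x y" and "L \<ge> 0"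
  shows "\<bar>expectation (\<lambda>\<omega>. G (rescaled_walk n (\<lambda>i. X i \<omega>)))
      - expectation (\<lambda>\<omega>. G (grid_path q (rescaled_walk n (\<lambda>i. X i \<omega>))))\<bar>
    \<le> L * e + 2 * C * (real (q * q) * (6 * exp (- (e\<^sup>2 * real q / (144 * K\<^sup>2)))))"
proof -
  have X [measurable]: "X i \<in> borel_measurable M" if "i \<ge> 1" for i
    using indep that unfolding indep_vars_def by auto
  have walk: "(\<lambda>\<omega>. rescaled_walk n (\<lambda>i. X i \<omega>) t) \<in> borel_measurable M" if "t \<ge> 0" for t
    using that by (auto simp: rescaled_walk_def intro!: borel_measurable_times borel_measurable_sum X)
  have e: "e > 0" using q(1,3) by (intro order_less_le_trans[OF _ q(3)]) simp
  have n: "n > 0" using q by simp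
  have "C \<ge> 0" using C[OF rescaled_walk_in_cadlag[of 0 "\<lambda>_. 0"]] by linarith
  \<comment> \<open>A common positive bound for the numbers of steps between neighbouring grid times, some of which
     may be smaller; with \<open>l = 0\<close> the tail estimate would be void.\<close>
  define l where "l = nat \<lfloor>2 * real n / real q\<rfloor>"
  have l: "2 * real n / real q < real l + 1" "real l \<le> 2 * real n / real q"
    using q by (simp_all add: l_def)
  have "2 \<le> 2 * real n / real q" using q by (simp add: field_simps)
  then have "l > 0" using l by linarith
  define L' where "L' j = nat \<lfloor>real n * (real j / real q)\<rfloor>" for j
  define bad where "bad j = {\<omega> \<in> space M. \<exists>k\<le>l. e * sqrt (real n) \<le> \<bar>\<Sum>i=1..k. X (L' j + i) \<omega>\<bar>}" for j
  have [measurable]: "bad j \<in> events" for j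
  proof -
    have [measurable]: "(\<lambda>\<omega>. \<Sum>i=1..k. X (L' j + i) \<omega>) \<in> borel_measurable M" for k
      by (intro borel_measurable_sum X) auto
    have "bad j = {\<omega> \<in> space M. \<exists>k\<in>{..l}. e * sqrt (real n) \<le> \<bar>\<Sum>i=1..k. X (L' j + i) \<omega>\<bar>}"
      by (auto simp: bad_def)
    also have "\<dots> \<in> events" by measurable
    finally show ?thesis .
  qed
  have bad: "prob (bad j) \<le> 6 * exp (- (e\<^sup>2 * real q / (144 * K\<^sup>2)))" for j
  proof -
    have "prob (bad j) \<le> 6 * exp (- ((e * sqrt (real n))\<^sup>2 / (72 * real l * K\<^sup>2)))"
      unfolding bad_def
    proof (rule partial_sum_oscillation_tail[OF indep K bdd, where d="d / sqrt (real n)"])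
      show mean': "\<bar>expectation (X i)\<bar> \<le> d / sqrt (real n)" if "i \<ge> 1" for i
        using mean[OF that] n by (simp add: field_simps)
      have "d / sqrt (real n) \<ge> 0" using order_trans[OF abs_ge_zero mean'[of 1]] by simp
      then have "real l * (d / sqrt (real n)) \<le> 2 * real n / real q * (d / sqrt (real n))"
        by (intro mult_right_mono l)
      also have "\<dots> = 2 * d / real q * (real n / sqrt (real n))" by simp
      also have "real n / sqrt (real n) = sqrt (real n)" by (simp add: real_div_sqrt)
      also have "2 * d / real q * sqrt (real n) \<le> e / 6 * sqrt (real n)"
        by (intro mult_right_mono q) simp
      finally show "real l * (d / sqrt (real n)) \<le> e * sqrt (real n) / 6" by simp
    qed (use e n in simp_all)
    also have "e\<^sup>2 * real q / (144 * K\<^sup>2) \<le> (e * sqrt (real n))\<^sup>2 / (72 * real l * K\<^sup>2)"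
    proof -
      have "e\<^sup>2 * real q / (144 * K\<^sup>2) = e\<^sup>2 * real n / (72 * (2 * real n / real q) * K\<^sup>2)"
        using n q by simp
      also have "\<dots> \<le> e\<^sup>2 * real n / (72 * real l * K\<^sup>2)"
        using l \<open>l > 0\<close> K n q(1) by (intro divide_left_mono mult_mono mult_pos_pos) auto
      finally show ?thesis using n by (simp add: power_mult_distrib)
    qed
    then have "6 * exp (- ((e * sqrt (real n))\<^sup>2 / (72 * real l * K\<^sup>2))) \<le> 6 * exp (- (e\<^sup>2 * real q / (144 * K\<^sup>2)))"
      by simp
    finally show ?thesis .
  qed
  define Bad where "Bad = (\<Union>j\<in>{..<q * q}. bad j)"
  have [measurable]: "Bad \<in> events" unfolding Bad_def by (intro sets.finite_UN) auto
  have "prob Bad \<le> (\<Sum>j\<in>{..<q * q}. prob (bad j))"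
    unfolding Bad_def by (intro finite_measure_subadditive_finite) auto
  also have "\<dots> \<le> (\<Sum>j\<in>{..<q * q}. 6 * exp (- (e\<^sup>2 * real q / (144 * K\<^sup>2))))"
    by (intro sum_mono bad)
  finally have Bad: "prob Bad \<le> real (q * q) * (6 * exp (- (e\<^sup>2 * real q / (144 * K\<^sup>2))))" by simp
  define Y where "Y \<omega> = rescaled_walk n (\<lambda>i. X i \<omega>)" for \<omega>
  have cad: "Y \<omega> \<in> cadlag" "grid_path q (Y \<omega>) \<in> cadlag" for \<omega>
    by (simp_all add: Y_def rescaled_walk_in_cadlag grid_path_in_cadlag)
  have close: "\<bar>G (Y \<omega>) - G (grid_path q (Y \<omega>))\<bar> \<le> L * e + 2 * C * indicator Bad \<omega>"
    if "\<omega> \<in> space M" for \<omega>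
  proof (cases "\<omega> \<in> Bad")
    case True
    have "0 \<le> L * e" using \<open>L \<ge> 0\<close> e by simp
    then show ?thesis using True C[OF cad(1), of \<omega>] C[OF cad(2), of \<omega>] by simp
  next
    case False
    have "lu_dist (Y \<omega>) (grid_path q (Y \<omega>)) \<le> e"
      unfolding Y_def
    proof (rule lu_dist_rescaled_walk_grid_path[OF q(1-3) l(1)])
      fix j k assume "j < q * q" "k \<le> l"
      then have "\<omega> \<notin> bad j" using False by (auto simp: Bad_def)
      then show "\<bar>\<Sum>i=1..k. X (nat \<lfloor>real n * (real j / real q)\<rfloor> + i) \<omega>\<bar> \<le> e * sqrt (real n)"
        using that \<open>k \<le> l\<close> unfolding bad_def L'_def by force
    qed
    then have "L * lu_dist (Y \<omega>) (grid_path q (Y \<omega>)) \<le> L * e" using \<open>L \<ge> 0\<close> by (rule mult_left_mono)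
    then show ?thesis using L[OF cad, of \<omega> \<omega>] False by simp
  qed
  have int: "integrable M (\<lambda>\<omega>. G (Y \<omega>))" "integrable M (\<lambda>\<omega>. G (grid_path q (Y \<omega>)))"
  proof -
    show "integrable M (\<lambda>\<omega>. G (grid_path q (Y \<omega>)))"
      by (rule integrable_const_bound[where B=C])
         (use C cad walk in \<open>auto simp: Y_def intro!: measurable_lipschitz_grid_path[OF G]\<close>)
    have "(\<lambda>\<omega>. G (Y \<omega>)) \<in> borel_measurable M"
      unfolding Y_def rescaled_walk_eq_step_path
      by (rule measurable_lipschitz_step_path[OF G])
         (intro borel_measurable_times borel_measurable_const borel_measurable_sum X, simp)
    then show "integrable M (\<lambda>\<omega>. G (Y \<omega>))"
      by (intro integrable_const_bound[where B=C]) (use C cad in auto)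
  qed
  have const: "integrable M (\<lambda>_. L * e)" and ind: "integrable M (\<lambda>\<omega>. 2 * C * indicator Bad \<omega>)"
    by (auto intro!: integrable_real_indicator simp: less_top[symmetric])
  have "\<bar>expectation (\<lambda>\<omega>. G (Y \<omega>)) - expectation (\<lambda>\<omega>. G (grid_path q (Y \<omega>)))\<bar>
      = \<bar>expectation (\<lambda>\<omega>. G (Y \<omega>) - G (grid_path q (Y \<omega>)))\<bar>"
    using int by simp
  also have "\<dots> \<le> expectation (\<lambda>\<omega>. \<bar>G (Y \<omega>) - G (grid_path q (Y \<omega>))\<bar>)"
    by (rule integral_abs_bound)
  also have "\<dots> \<le> expectation (\<lambda>\<omega>. L * e + 2 * C * indicator Bad \<omega>)"
    by (intro integral_mono integrable_abs Bochner_Integration.integrable_diff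
        Bochner_Integration.integrable_add int const ind close)
  also have "\<dots> = L * e + 2 * C * prob Bad"
    unfolding Bochner_Integration.integral_add[OF const ind] by (simp add: prob_space)
  also have "\<dots> \<le> L * e + 2 * C * (real (q * q) * (6 * exp (- (e\<^sup>2 * real q / (144 * K\<^sup>2)))))"
    using Bad \<open>C \<ge> 0\<close> by (intro add_left_mono mult_left_mono) auto
  finally show ?thesis by (simp add: Y_def)
qed

lemma tendsto_square_exp_0:
  assumes "c > 0"
  shows "(\<lambda>q. real (q * q) * (6 * exp (- (c * real q)))) \<longlonglongrightarrow> 0"
proof -
  have "filterlim (\<lambda>q. c * real q) at_top sequentially"
    using assms by (intro filterlim_tendsto_pos_mult_at_top[OF tendsto_const] filterlim_real_sequentially)
  then have "(\<lambda>q. (c * real q) ^ 2 / exp (c * real q)) \<longlonglongrightarrow> 0"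
    by (rule filterlim_compose[OF tendsto_power_div_exp_0])
  from tendsto_mult_left[OF this, of "6 / c\<^sup>2"] show ?thesis
    using assms by (simp add: exp_minus field_simps power2_eq_square)
qed

text \<open>
  The rows are indexed by \<open>r\<close> and the scale \<open>n r\<close> is a separate sequence, so that finitely many rows can
  be dropped by a shift of \<open>r\<close>.
\<close>

theorem walk_converges_to_brownian_motion_with_drift:
  fixes M :: "nat \<Rightarrow> 'a measure" and X :: "nat \<Rightarrow> nat \<Rightarrow> 'a \<Rightarrow> real" and n :: "nat \<Rightarrow> nat"
    and P :: "'c measure" and B :: "real \<Rightarrow> 'c \<Rightarrow> real"
  assumes \<nu>: "\<And>r. real_distribution (\<nu> r)" and K: "K > 0" "\<And>r. AE x in \<nu> r. \<bar>x\<bar> \<le> K"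
    and n: "filterlim n at_top sequentially"
    and mean: "(\<lambda>r. sqrt (real (n r)) * (LINT x|\<nu> r. x)) \<longlonglongrightarrow> b"
    and var: "(\<lambda>r. LINT x|\<nu> r. x\<^sup>2) \<longlonglongrightarrow> \<sigma>\<^sup>2"
    and prob: "\<And>r. prob_space (M r)"
    and indep: "\<And>r. prob_space.indep_vars (M r) (\<lambda>_. borel) (X r) {1..}"
    and law: "\<And>r i. i \<ge> 1 \<Longrightarrow> distr (M r) borel (X r i) = \<nu> r"
    and brownian: "standard_brownian_motion P B"
  shows "converges_in_distribution skorokhod M (\<lambda>r \<omega>. rescaled_walk (n r) (\<lambda>i. X r i \<omega>))
     P (\<lambda>\<omega>. \<lambda>t\<in>{0..}. \<sigma> * B t \<omega> + b * t)"
proof -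
  interpret M: prob_space "M r" for r by (rule prob)
  interpret P: prob_space P using brownian by (simp add: standard_brownian_motion_def)
  define Y where "Y r \<omega> = rescaled_walk (n r) (\<lambda>i. X r i \<omega>)" for r \<omega>
  define Z where "Z \<omega> = (\<lambda>t\<in>{0..}. \<sigma> * B t \<omega> + b * t)" for \<omega>
  have X: "X r i \<in> borel_measurable (M r)" if "i \<ge> 1" for r i
    using indep[of r] that unfolding M.indep_vars_def by auto
  have bdd: "AE \<omega> in M r. \<bar>X r i \<omega>\<bar> \<le> K" if "i \<ge> 1" for r i
    using K(2)[of r] unfolding law[OF that, symmetric] by (subst (asm) AE_distr_iff) (use X[OF that] in auto)
  have EX: "M.expectation r (X r i) = (LINT x|\<nu> r. x)" if "i \<ge> 1" for r i
    unfolding law[OF that, symmetric] using X[OF that] by (simp add: integral_distr)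
  have B: "B t \<in> borel_measurable P" if "t \<ge> 0" for t
    using brownian that by (simp add: standard_brownian_motion_def)
  have Zt: "(\<lambda>\<omega>. Z \<omega> t) \<in> borel_measurable P" if "t \<ge> 0" for t
    using B[OF that] that by (simp add: Z_def)
  have Zcont: "continuous_on {0..} (\<lambda>t. \<sigma> * B t \<omega> + b * t)" if "\<omega> \<in> space P" for \<omega>
    using brownian that by (intro continuous_intros) (simp add: standard_brownian_motion_def)
  have measY: "(\<lambda>\<omega>. G (Y r \<omega>)) \<in> borel_measurable (M r)" if "bdd_lipschitz G" for G r
    unfolding Y_def rescaled_walk_eq_step_path
    by (rule measurable_lipschitz_step_path[OF that])
       (intro borel_measurable_times borel_measurable_const borel_measurable_sum X, simp)
  have measZ: "(\<lambda>\<omega>. G (Z \<omega>)) \<in> borel_measurable P" if "bdd_lipschitz G" for G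
    unfolding Z_def using B Zcont by (intro measurable_lipschitz_continuous[OF that]) auto
  have Zcad: "Z \<omega> \<in> cadlag" if "\<omega> \<in> space P" for \<omega>
    unfolding Z_def by (rule continuous_in_cadlag[OF Zcont[OF that]])
  have grid_conv: "(\<lambda>r. LINT \<omega>|M r. G (grid_path q (Y r \<omega>))) \<longlonglongrightarrow> (LINT \<omega>|P. G (grid_path q (Z \<omega>)))"
    if G: "bdd_lipschitz G" and "q \<ge> 1" for G q
  proof -
    obtain C where C: "\<And>x. x \<in> cadlag \<Longrightarrow> \<bar>G x\<bar> \<le> C" using bdd_lipschitzE[OF G] by metis
    \<comment> \<open>\<open>L r j\<close> is the number of steps up to the grid time \<open>j / q\<close>.\<close>
    define L where "L r j = nat \<lfloor>real (n r) * (real j / real q)\<rfloor>" for r j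
    define \<xi> where "\<xi> r j \<omega> = 1 / sqrt (real (n r)) * (\<Sum>i\<in>{L r j<..L r (Suc j)}. X r i \<omega>)" for r j \<omega>
    define \<zeta> where "\<zeta> j \<omega> = \<sigma> * (B (real (Suc j) / real q) \<omega> - B (real j / real q) \<omega>)
        + b * (real (Suc j) / real q - real j / real q)" for j \<omega>
    have \<zeta>: "\<zeta> j \<in> borel_measurable P" for j
      unfolding \<zeta>_def[abs_def]
      by (intro borel_measurable_add borel_measurable_times
          borel_measurable_diff borel_measurable_const B) auto
    have L_mono: "L r j \<le> L r j'" if "j \<le> j'" for r j j'
      unfolding L_def using that \<open>q \<ge> 1\<close>
      by (intro nat_mono floor_mono mult_left_mono divide_right_mono) auto
    have "(\<lambda>r. LINT \<omega>|M r. G (path_of_increments q (\<lambda>j\<in>{..<q * q}. \<xi> r j \<omega>)))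
        \<longlonglongrightarrow> (LINT \<omega>|P. G (path_of_increments q (\<lambda>j\<in>{..<q * q}. \<zeta> j \<omega>)))"
    proof (rule weak_conv_independent_components)
      show "M.indep_vars r (\<lambda>_. borel) (\<xi> r) {..<q * q}" for r
      proof -
        have disj: "disjoint_family_on (\<lambda>j. {L r j<..L r (Suc j)}) {..<q * q}"
          unfolding disjoint_family_on_def
        proof (intro ballI impI)
          fix i j :: nat assume "i \<noteq> j"
          then have "L r (Suc i) \<le> L r j \<or> L r (Suc j) \<le> L r i"
            using L_mono[of "Suc i" j r] L_mono[of "Suc j" i r] by linarith
          then show "{L r i<..L r (Suc i)} \<inter> {L r j<..L r (Suc j)} = {}" by auto
        qed
        have "M.indep_vars r (\<lambda>_. borel) (\<lambda>j \<omega>. 1 / sqrt (real (n r)) *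
            (\<Sum>i\<in>{L r j<..L r (Suc j)}. (\<lambda>i\<in>{L r j<..L r (Suc j)}. X r i \<omega>) i)) {..<q * q}"
        proof (rule M.indep_vars_compose2[OF M.indep_vars_restrict[OF indep _ disj]])
          show "(\<lambda>y. 1 / sqrt (real (n r)) * (\<Sum>i\<in>{L r j<..L r (Suc j)}. y i))
            \<in> borel_measurable (PiM {L r j<..L r (Suc j)} (\<lambda>_. borel))" for j
            by (intro borel_measurable_times borel_measurable_const borel_measurable_sum
                measurable_component_singleton)
        qed auto
        then show ?thesis by (simp add: \<xi>_def[abs_def])
      qed
      show "P.indep_vars (\<lambda>_. borel) \<zeta> {..<q * q}"
      proof -
        have "P.indep_vars (\<lambda>_. borel)
          (\<lambda>i \<omega>. B (real (Suc i) / real q) \<omega> - B (real i / real q) \<omega>) {..<q * q}"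
          using brownian unfolding standard_brownian_motion_def
          by (elim conjE allE[of _ "q * q"] allE[of _ "\<lambda>i. real i / real q"])
             (auto simp: divide_right_mono)
        from P.indep_vars_compose2[OF this, of "\<lambda>i x. \<sigma> * x + b * (real (Suc i) / real q - real i / real q)" "\<lambda>_. borel"]
        show ?thesis by (simp add: \<zeta>_def[abs_def])
      qed
      show "weak_conv_m (\<lambda>r. distr (M r) borel (\<xi> r j)) (distr P borel (\<zeta> j))" for j
        unfolding \<xi>_def[abs_def]
      proof (rule bounded_rows_central_limit[OF \<nu> K(2) n mean var prob])
        show "M.indep_vars r (\<lambda>_. borel) (X r) {L r j<..L r (Suc j)}" for r
          by (rule M.indep_vars_subset[OF indep]) auto
        show "distr (M r) borel (X r i) = \<nu> r" if "i \<in> {L r j<..L r (Suc j)}" for r i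
          using that by (intro law) auto
        have "(\<lambda>r. real (L r (Suc j)) / real (n r) - real (L r j) / real (n r))
            \<longlonglongrightarrow> real (Suc j) / real q - real j / real q"
          unfolding L_def by (intro tendsto_diff nat_floor_lim n) auto
        moreover have "real (L r (Suc j)) / real (n r) - real (L r j) / real (n r)
            = real (card {L r j<..L r (Suc j)}) / real (n r)" for r
          using L_mono[of j "Suc j" r] by (simp add: of_nat_diff diff_divide_distrib)
        ultimately show "(\<lambda>r. real (card {L r j<..L r (Suc j)}) / real (n r))
            \<longlonglongrightarrow> real (Suc j) / real q - real j / real q" by simp
        show "real_distribution (distr P borel (\<zeta> j))" by (rule P.real_distribution_distr[OF \<zeta>])
        have lt: "real j / real q < real (Suc j) / real q"
          using \<open>q \<ge> 1\<close> by (intro divide_strict_right_mono) auto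
        show "char (distr P borel (\<zeta> j)) t
          = exp (of_real (real (Suc j) / real q - real j / real q) * (\<i> * t * b - t\<^sup>2 * \<sigma>\<^sup>2 / 2))" for t
          unfolding \<zeta>_def[abs_def]
          using brownian lt unfolding standard_brownian_motion_def
          by (intro char_brownian_increment P.prob_space_axioms) auto
      qed
      show "(\<lambda>y. G (path_of_increments q y)) \<in> borel_measurable (PiM {..<q * q} (\<lambda>_. borel))"
        unfolding path_of_increments_def
        by (rule measurable_lipschitz_step_path[OF G])
           (intro borel_measurable_sum measurable_component_singleton, simp)
      show "\<bar>G (path_of_increments q y)\<bar> \<le> C" for y by (rule C[OF path_of_increments_in_cadlag])
      show "(\<lambda>r. G (path_of_increments q (u r))) \<longlonglongrightarrow> G (path_of_increments q y)"
        if "\<And>j. j < q * q \<Longrightarrow> (\<lambda>r. u r j) \<longlonglongrightarrow> y j" for u y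
        unfolding path_of_increments_def
        by (intro bdd_lipschitz_tendsto[OF G] step_path_in_cadlag lu_dist_step_path_tendsto
            tendsto_sum that) auto
    qed (use M.prob_space_axioms P.prob_space_axioms in auto)
    moreover have "G (path_of_increments q (\<lambda>j\<in>{..<q * q}. \<xi> r j \<omega>)) = G (grid_path q (Y r \<omega>))" for r \<omega>
    proof -
      have "Y r \<omega> (real (Suc j) / real q) - Y r \<omega> (real j / real q) = \<xi> r j \<omega>" for j
        unfolding Y_def \<xi>_def L_def by (rule rescaled_walk_diff) (auto simp: divide_right_mono)
      then show ?thesis
        using grid_path_eq_path_of_increments[of "Y r \<omega>" q] by (simp add: Y_def)
    qed
    moreover have "(LINT \<omega>|P. G (path_of_increments q (\<lambda>j\<in>{..<q * q}. \<zeta> j \<omega>)))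
        = (LINT \<omega>|P. G (grid_path q (Z \<omega>)))"
    proof (rule integral_cong_AE)
      have "AE \<omega> in P. B 0 \<omega> = 0" using brownian by (simp add: standard_brownian_motion_def)
      then show "AE \<omega> in P. G (path_of_increments q (\<lambda>j\<in>{..<q * q}. \<zeta> j \<omega>)) = G (grid_path q (Z \<omega>))"
      proof eventually_elim
        case (elim \<omega>)
        have "Z \<omega> (real (Suc j) / real q) - Z \<omega> (real j / real q) = \<zeta> j \<omega>" for j
          by (simp add: Z_def \<zeta>_def algebra_simps)
        then show ?case
          using grid_path_eq_path_of_increments[of "Z \<omega>" q] elim by (simp add: Z_def)
      qed
      show "(\<lambda>\<omega>. G (path_of_increments q (\<lambda>j\<in>{..<q * q}. \<zeta> j \<omega>))) \<in> borel_measurable P"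
        unfolding path_of_increments_def
        by (rule measurable_lipschitz_step_path[OF G])
           (auto intro!: borel_measurable_sum \<zeta>)
      show "(\<lambda>\<omega>. G (grid_path q (Z \<omega>))) \<in> borel_measurable P"
        by (rule measurable_lipschitz_grid_path[OF G Zt])
    qed
    ultimately show ?thesis by simp
  qed
  show ?thesis
    unfolding Y_def[symmetric] Z_def[symmetric]
  proof (rule converges_in_distribution_skorokhodI)
    show "prob_space (M r)" for r by (rule M.prob_space_axioms)
    show "prob_space P" by (rule P.prob_space_axioms)
    show "Z \<omega> \<in> cadlag" if "\<omega> \<in> space P" for \<omega> by (rule Zcad[OF that])
    show "(\<lambda>\<omega>. G (Y r \<omega>)) \<in> borel_measurable (M r)" if "bdd_lipschitz G" for G r by (rule measY[OF that])
    show "(\<lambda>\<omega>. G (Z \<omega>)) \<in> borel_measurable P" if "bdd_lipschitz G" for G by (rule measZ[OF that])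
    show "Y r \<omega> \<in> cadlag" for r \<omega> by (simp add: Y_def rescaled_walk_in_cadlag)
    fix G assume G: "bdd_lipschitz G"
    obtain C L where C: "C > 0" "\<And>x. x \<in> cadlag \<Longrightarrow> \<bar>G x\<bar> \<le> C" and "L > 0"
      and L: "\<And>x y. x \<in> cadlag \<Longrightarrow> y \<in> cadlag \<Longrightarrow> \<bar>G x - G y\<bar> \<le> L * lu_dist x y"
      using bdd_lipschitzE[OF G] by metis
    show "(\<lambda>r. LINT \<omega>|M r. G (Y r \<omega>)) \<longlonglongrightarrow> (LINT \<omega>|P. G (Z \<omega>))"
    proof (rule tendstoI)
      fix \<eta> :: real assume "\<eta> > 0"
      \<comment> \<open>Two grid errors and the difference on the grid get \<open>\<eta> / 3\<close> each.  The bound on the grid error of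
         the walk has two terms, of \<open>\<eta> / 6\<close> each, and requires \<open>d\<close> to dominate the scaled means.\<close>
      define e where "e = \<eta> / (6 * L)"
      define d where "d = \<bar>b\<bar> + 1"
      have e: "e > 0" "L * e = \<eta> / 6" using \<open>\<eta> > 0\<close> \<open>L > 0\<close> by (simp_all add: e_def)
      have Zgrid: "(\<lambda>q. LINT \<omega>|P. G (grid_path q (Z \<omega>))) \<longlonglongrightarrow> (LINT \<omega>|P. G (Z \<omega>))"
      proof (rule integral_dominated_convergence[where w="\<lambda>_. C"])
        show "AE \<omega> in P. (\<lambda>q. G (grid_path q (Z \<omega>))) \<longlonglongrightarrow> G (Z \<omega>)"
          using Zcont unfolding Z_def by (intro AE_I2 lipschitz_grid_path_tendsto[OF G]) auto
        show "(\<lambda>\<omega>. G (grid_path q (Z \<omega>))) \<in> borel_measurable P" for q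
          by (rule measurable_lipschitz_grid_path[OF G Zt])
      qed (use C measZ[OF G] grid_path_in_cadlag in auto)
      have "\<forall>\<^sub>F q in sequentially. \<bar>(LINT \<omega>|P. G (grid_path q (Z \<omega>))) - (LINT \<omega>|P. G (Z \<omega>))\<bar> < \<eta> / 3"
        using tendstoD[OF Zgrid, of "\<eta> / 3"] \<open>\<eta> > 0\<close> by (simp add: dist_real_def)
      moreover have "\<forall>\<^sub>F q in sequentially. 2 * C * (real (q * q) * (6 * exp (- (e\<^sup>2 / (144 * K\<^sup>2) * real q)))) < \<eta> / 6"
        using tendsto_mult_left[OF tendsto_square_exp_0, of "e\<^sup>2 / (144 * K\<^sup>2)" "2 * C"] e K(1) \<open>\<eta> > 0\<close>
        by (intro order_tendstoD(2)) auto
      moreover have "\<forall>\<^sub>F q in sequentially. 1 / (1 + real q) < e"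
        using e by (intro order_tendstoD(2)[OF LIMSEQ_inverse_real_of_nat[unfolded inverse_eq_divide of_nat_Suc]])
      moreover have "\<forall>\<^sub>F q in sequentially. 2 * d / real q < e / 6"
        using e by (intro order_tendstoD(2)[OF lim_const_over_n]) auto
      moreover have "\<forall>\<^sub>F q in sequentially. q \<ge> (1::nat)" by (rule eventually_ge_at_top)
      ultimately have "\<forall>\<^sub>F q in sequentially.
        \<bar>(LINT \<omega>|P. G (grid_path q (Z \<omega>))) - (LINT \<omega>|P. G (Z \<omega>))\<bar> < \<eta> / 3 \<and>
        2 * C * (real (q * q) * (6 * exp (- (e\<^sup>2 / (144 * K\<^sup>2) * real q)))) < \<eta> / 6 \<and>
        1 / (1 + real q) < e \<and> 2 * d / real q < e / 6 \<and> q \<ge> 1"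
        by eventually_elim blast
      then obtain q where q: "\<bar>(LINT \<omega>|P. G (grid_path q (Z \<omega>))) - (LINT \<omega>|P. G (Z \<omega>))\<bar> < \<eta> / 3"
        "2 * C * (real (q * q) * (6 * exp (- (e\<^sup>2 / (144 * K\<^sup>2) * real q)))) < \<eta> / 6"
        "1 / (1 + real q) < e" "2 * d / real q < e / 6" "q \<ge> 1"
        using eventually_happens'[OF sequentially_bot] by blast
      have "\<forall>\<^sub>F r in sequentially. n r \<ge> q" using n by (simp add: filterlim_at_top)
      moreover have "\<forall>\<^sub>F r in sequentially. \<bar>sqrt (real (n r)) * (LINT x|\<nu> r. x)\<bar> < d"
        using tendsto_rabs[OF mean] by (rule order_tendstoD(2)) (simp add: d_def)
      moreover have "\<forall>\<^sub>F r in sequentially. \<bar>(LINT \<omega>|M r. G (grid_path q (Y r \<omega>))) - (LINT \<omega>|P. G (grid_path q (Z \<omega>)))\<bar> < \<eta> / 3"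
        using tendstoD[OF grid_conv[OF G q(5)], of "\<eta> / 3"] \<open>\<eta> > 0\<close> by (simp add: dist_real_def)
      ultimately show "\<forall>\<^sub>F r in sequentially. dist (LINT \<omega>|M r. G (Y r \<omega>)) (LINT \<omega>|P. G (Z \<omega>)) < \<eta>"
      proof eventually_elim
        case (elim r)
        have "\<bar>(LINT \<omega>|M r. G (Y r \<omega>)) - (LINT \<omega>|M r. G (grid_path q (Y r \<omega>)))\<bar>
          \<le> L * e + 2 * C * (real (q * q) * (6 * exp (- (e\<^sup>2 * real q / (144 * K\<^sup>2)))))"
          unfolding Y_def
        proof (rule M.lipschitz_rescaled_walk_grid_path[OF indep K(1) bdd _ q(5) elim(1) _ _ G C(2) L])
          show "sqrt (real (n r)) * \<bar>M.expectation r (X r i)\<bar> \<le> d" if "i \<ge> 1" for i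
            using elim(2) by (simp add: EX[OF that] abs_mult)
        qed (use q \<open>L > 0\<close> in auto)
        also have "\<dots> < \<eta> / 3" using q(2) e(2) by (simp add: field_simps)
        finally show ?case using elim(3) q(1) unfolding dist_real_def by linarith
      qed
    qed
  qed
qed

section \<open>Moments of the approximating measures\<close>

text \<open>
  The complement of the support is a union of open null sets, and by Lindelof's theorem countably many
  of them suffice.
\<close>

lemma AE_in_measure_support:
  fixes M :: "'a::second_countable_topology measure"
  assumes M: "sets M = sets borel"
  shows "AE x in M. x \<in> measure_support M"
proof -
  define \<N> where "\<N> = {U. open U \<and> emeasure M U = 0}"
  obtain \<N>' where \<N>': "\<N>' \<subseteq> \<N>" "countable \<N>'" "\<Union>\<N>' = \<Union>\<N>"
    using Lindelof[of \<N>] by (auto simp: \<N>_def)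
  have "U \<in> null_sets M" if "U \<in> \<N>'" for U
    using that \<N>'(1) by (auto simp: \<N>_def null_sets_def M)
  then have "\<Union>\<N> \<in> null_sets M"
    using null_sets_UN'[OF \<N>'(2), of "\<lambda>U. U" M] by (simp add: \<N>'(3))
  moreover have "{x \<in> space M. x \<notin> measure_support M} \<subseteq> \<Union>\<N>"
    by (auto simp: measure_support_def \<N>_def zero_less_iff_neq_zero)
  ultimately show ?thesis by (rule AE_I')
qed

lemma AE_bounded_of_compact_support:
  fixes M :: "real measure"
  assumes "sets M = sets borel" "compact (measure_support M)"
  obtains K where "K > 0" "AE x in M. \<bar>x\<bar> \<le> K"
proof -
  obtain K where K: "K > 0" "\<And>x. x \<in> measure_support M \<Longrightarrow> \<bar>x\<bar> \<le> K"
    using compact_imp_bounded[OF assms(2)] by (auto simp: bounded_pos)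
  have "AE x in M. \<bar>x\<bar> \<le> K"
    using AE_in_measure_support[OF assms(1)] by eventually_elim (rule K(2))
  with K(1) show thesis by (rule that)
qed

context
  fixes \<mu> :: "real measure" and K :: real
  assumes \<mu>: "real_distribution \<mu>" and K: "AE x in \<mu>. \<bar>x\<bar> \<le> K"
begin

interpretation \<mu>: real_distribution \<mu> by (rule \<mu>)
interpretation Q: pair_prob_space \<mu> \<mu> ..

lemma sets_\<mu> [measurable_cong]: "sets \<mu> = sets borel" by simp

lemma AE_pair_bounded: "AE z in \<mu> \<Otimes>\<^sub>M \<mu>. \<bar>fst z\<bar> \<le> K \<and> \<bar>snd z\<bar> \<le> K"
proof (rule Q.AE_pair_measure)
  show "{x \<in> space (\<mu> \<Otimes>\<^sub>M \<mu>). \<bar>fst x\<bar> \<le> K \<and> \<bar>snd x\<bar> \<le> K} \<in> sets (\<mu> \<Otimes>\<^sub>M \<mu>)"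
    by measurable
  show "AE x in \<mu>. AE y in \<mu>. \<bar>fst (x, y)\<bar> \<le> K \<and> \<bar>snd (x, y)\<bar> \<le> K"
    using K
  proof eventually_elim
    case (elim x)
    show ?case using K by eventually_elim (use elim in simp)
  qed
qed

lemma integrable_pair_on_box:
  assumes F: "F \<in> borel_measurable (\<mu> \<Otimes>\<^sub>M \<mu>)"
    and C: "\<And>v u. 0 \<le> v \<Longrightarrow> v \<le> K \<Longrightarrow> - K \<le> u \<Longrightarrow> u < 0 \<Longrightarrow> \<bar>F (v, u)\<bar> \<le> C"
  shows "integrable (\<mu> \<Otimes>\<^sub>M \<mu>) (\<lambda>z. indicator ({0..} \<times> {..<0}) z * F z :: real)"
proof (rule Q.P.integrable_const_bound[where B="max C 0"])
  show "AE z in \<mu> \<Otimes>\<^sub>M \<mu>. norm (indicator ({0..} \<times> {..<0}) z * F z) \<le> max C 0"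
    using AE_pair_bounded
  proof eventually_elim
    case (elim z)
    then show ?case using C[of "fst z" "snd z"]
      by (cases z) (auto simp: indicator_def abs_le_iff)
  qed
  show "(\<lambda>z. indicator ({0..} \<times> {..<0}) z * F z) \<in> borel_measurable (\<mu> \<Otimes>\<^sub>M \<mu>)"
    by (intro borel_measurable_times borel_measurable_indicator F) simp
qed

text \<open>
  Up to null sets only the box \<open>0 \<le> v \<le> K\<close>, \<open>-K \<le> u < 0\<close> matters.  This permits simplifying the
  integrand there, and passing to one integral over the product measure, which is linear in the
  integrand because bounded functions on the box are integrable.
\<close>

lemma iterated_integral_eq_pair:
  fixes F F' :: "real \<Rightarrow> real \<Rightarrow> real"
  assumes F: "(\<lambda>z. F (fst z) (snd z)) \<in> borel_measurable (borel \<Otimes>\<^sub>M borel)"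
    and F': "(\<lambda>z. F' (fst z) (snd z)) \<in> borel_measurable (borel \<Otimes>\<^sub>M borel)"
    and eq: "\<And>v u. 0 \<le> v \<Longrightarrow> v \<le> K \<Longrightarrow> - K \<le> u \<Longrightarrow> u < 0 \<Longrightarrow> F v u = F' v u"
    and C: "\<And>v u. 0 \<le> v \<Longrightarrow> v \<le> K \<Longrightarrow> - K \<le> u \<Longrightarrow> u < 0 \<Longrightarrow> \<bar>F' v u\<bar> \<le> C"
  shows "(LINT v:{0..}|\<mu>. LINT u:{..<0}|\<mu>. F v u) =
    (LINT z|(\<mu> \<Otimes>\<^sub>M \<mu>). indicator ({0..} \<times> {..<0}) z * F' (fst z) (snd z))"
proof -
  have [measurable]: "(\<lambda>z. F (fst z) (snd z)) \<in> borel_measurable (\<mu> \<Otimes>\<^sub>M \<mu>)"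
    "(\<lambda>z. F' (fst z) (snd z)) \<in> borel_measurable (\<mu> \<Otimes>\<^sub>M \<mu>)"
    using F F' by simp_all
  have [measurable]: "(\<lambda>z. indicator {0..} (fst z) * (indicator {..<0} (snd z) * F (fst z) (snd z))) \<in> borel_measurable (\<mu> \<Otimes>\<^sub>M \<mu>)"
    "(\<lambda>z. indicator {0..} (fst z) * (indicator {..<0} (snd z) * F' (fst z) (snd z))) \<in> borel_measurable (\<mu> \<Otimes>\<^sub>M \<mu>)"
    by measurable
  have [measurable]: "(\<lambda>u. F v u) \<in> borel_measurable borel" "(\<lambda>u. F' v u) \<in> borel_measurable borel" for v
    using measurable_Pair2[OF F, of v] measurable_Pair2[OF F', of v] by simp_all
  have "(LINT v:{0..}|\<mu>. LINT u:{..<0}|\<mu>. F v u) =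
    (LINT v|\<mu>. LINT u|\<mu>. indicator {0..} v * (indicator {..<0} u * F v u))"
    by (simp add: set_lebesgue_integral_def)
  also have "\<dots> = (LINT v|\<mu>. LINT u|\<mu>. indicator {0..} v * (indicator {..<0} u * F' v u))"
  proof (rule integral_cong_AE)
    show "AE v in \<mu>. (LINT u|\<mu>. indicator {0..} v * (indicator {..<0} u * F v u))
      = (LINT u|\<mu>. indicator {0..} v * (indicator {..<0} u * F' v u))"
      using K
    proof eventually_elim
      case (elim v)
      show ?case
      proof (rule integral_cong_AE)
        show "AE u in \<mu>. indicator {0..} v * (indicator {..<0} u * F v u)
          = indicator {0..} v * (indicator {..<0} u * F' v u)"
          using K by eventually_elim (use elim eq[of v] in \<open>auto simp: indicator_def abs_le_iff\<close>)
      qed measurable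
    qed
  qed (rule \<mu>.borel_measurable_lebesgue_integral, simp add: split_beta')+
  also have "\<dots> = (LINT v|\<mu>. LINT u|\<mu>. (\<lambda>z. indicator ({0..} \<times> {..<0}) z * F' (fst z) (snd z)) (v, u))"
    by (simp add: indicator_times mult.assoc)
  also have "\<dots> = (LINT z|(\<mu> \<Otimes>\<^sub>M \<mu>). indicator ({0..} \<times> {..<0}) z * F' (fst z) (snd z))"
    using C by (intro Q.integral_fst' integrable_pair_on_box) auto
  finally show ?thesis .
qed

text \<open>
  Test functions have to be bounded, so \<open>x\<close> and \<open>x\<^sup>2\<close> are replaced by their truncations at \<open>\<plusminus>K\<close>; that the
  law lives on \<open>[-K, K]\<close> follows from a test function that vanishes exactly there.  The test
  function \<open>1\<close> shows that the normalizing constant is the correct one.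
\<close>

lemma is_mu_m_moments:
  assumes "K > 0" "\<beta> > 0"
  obtains D where "\<And>m N. is_mu_m \<mu> \<beta> m N \<Longrightarrow> AE x in N. \<bar>x\<bar> \<le> K"
    "\<And>m N. is_mu_m \<mu> \<beta> m N \<Longrightarrow> (LINT x|N. x) = - \<beta> / (2 * sqrt (real m))"
    "\<And>m N. is_mu_m \<mu> \<beta> m N \<Longrightarrow> (LINT x|N. x\<^sup>2) = sigma2 \<mu> \<beta> - \<beta> / (2 * sqrt (real m)) * D"
proof
  define W :: "real \<Rightarrow> real \<Rightarrow> real" where "W v u = exp (\<beta> * v) - exp (\<beta> * u)" for v u
  define c where "c = tilt_const \<mu> \<beta>"
  define A where "A f = (LINT z|(\<mu> \<Otimes>\<^sub>M \<mu>). indicator ({0..} \<times> {..<0}) z * (W (fst z) (snd z) * f z))"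
    for f :: "real \<times> real \<Rightarrow> real"
  have [measurable]: "(\<lambda>z. W (fst z) (snd z)) \<in> borel_measurable (borel \<Otimes>\<^sub>M borel)"
    unfolding W_def by measurable
  have W_bound: "\<bar>W v u\<bar> \<le> exp (\<beta> * K)" if "0 \<le> v" "v \<le> K" "- K \<le> u" "u < 0" for v u
  proof -
    have "exp (\<beta> * v) \<le> exp (\<beta> * K)" "exp (\<beta> * u) \<le> exp (\<beta> * v)" "0 < exp (\<beta> * u)"
      using that \<open>\<beta> > 0\<close> by auto
    then show ?thesis unfolding W_def by linarith
  qed
  have bound: "\<bar>W v u * f\<bar> \<le> exp (\<beta> * K) * C"
    if "0 \<le> v" "v \<le> K" "- K \<le> u" "u < 0" "\<bar>f\<bar> \<le> C" for v u f C
    unfolding abs_mult by (intro mult_mono W_bound that) auto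
  have A_lin: "A (\<lambda>z. f z - k * g z) = A f - k * A g"
    if fg: "f \<in> borel_measurable (borel \<Otimes>\<^sub>M borel)" "g \<in> borel_measurable (borel \<Otimes>\<^sub>M borel)"
      and C: "\<And>v u. 0 \<le> v \<Longrightarrow> v \<le> K \<Longrightarrow> - K \<le> u \<Longrightarrow> u < 0 \<Longrightarrow> \<bar>f (v, u)\<bar> \<le> C \<and> \<bar>g (v, u)\<bar> \<le> C"
    for f g k C
  proof -
    have "integrable (\<mu> \<Otimes>\<^sub>M \<mu>) (\<lambda>z. indicator ({0..} \<times> {..<0}) z * (W (fst z) (snd z) * h z))"
      if "h = f \<or> h = g" for h
      using that fg C by (intro integrable_pair_on_box[where C="exp (\<beta> * K) * C"]) (auto intro!: bound)
    from this[of f] this[of g] have "A f - k * A g =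
      (LINT z|(\<mu> \<Otimes>\<^sub>M \<mu>). indicator ({0..} \<times> {..<0}) z * (W (fst z) (snd z) * f z) - k *
        (indicator ({0..} \<times> {..<0}) z * (W (fst z) (snd z) * g z)))"
      unfolding A_def by simp
    also have "\<dots> = A (\<lambda>z. f z - k * g z)"
      unfolding A_def by (intro Bochner_Integration.integral_cong) (auto simp: algebra_simps)
    finally show ?thesis ..
  qed
  have uv_bound: "\<bar>u * v\<bar> \<le> K * K" "\<bar>u + v\<bar> \<le> 2 * K" if "0 \<le> v" "v \<le> K" "- K \<le> u" "u < 0" for u v
  proof -
    have "\<bar>u\<bar> * \<bar>v\<bar> \<le> K * K" using that by (intro mult_mono) auto
    then show "\<bar>u * v\<bar> \<le> K * K" by (simp add: abs_mult)
    show "\<bar>u + v\<bar> \<le> 2 * K" using that by simp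
  qed
  have sigma2: "sigma2 \<mu> \<beta> = - inverse c * A (\<lambda>z. snd z * fst z)"
    unfolding sigma2_def c_def A_def W_def[symmetric]
    by (subst iterated_integral_eq_pair[where F'="\<lambda>v u. W v u * (u * v)" and C="exp (\<beta> * K) * (K * K)"])
       (auto intro!: bound uv_bound)
  fix m N assume N: "is_mu_m \<mu> \<beta> m N"
  define \<kappa> where "\<kappa> = \<beta> / (2 * sqrt (real m))"
  interpret N: real_distribution N using N by (simp add: is_mu_m_def)
  \<comment> \<open>The denominators \<open>u - v\<close> are cleared in \<open>eq\<close>, so that \<open>f\<close> is a polynomial in the applications.\<close>
  have int: "(LINT x|N. \<phi> x) = inverse c * A f"
    if \<phi>: "continuous_on UNIV \<phi>" "bounded (range \<phi>)"
      and f [measurable]: "f \<in> borel_measurable (borel \<Otimes>\<^sub>M borel)"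
      and eq: "\<And>v u. 0 \<le> v \<Longrightarrow> v \<le> K \<Longrightarrow> - K \<le> u \<Longrightarrow> u < 0 \<Longrightarrow>
        (- v - \<kappa>) * \<phi> u + (u + \<kappa>) * \<phi> v = (u - v) * f (v, u)"
      and C: "\<And>v u. 0 \<le> v \<Longrightarrow> v \<le> K \<Longrightarrow> - K \<le> u \<Longrightarrow> u < 0 \<Longrightarrow> \<bar>f (v, u)\<bar> \<le> C"
    for \<phi> :: "real \<Rightarrow> real" and f C
  proof -
    have [measurable]: "\<phi> \<in> borel_measurable borel" by (rule borel_measurable_continuous_onI) (rule \<phi>(1))
    have "(LINT x|N. \<phi> x) = inverse c * (LINT v:{0..}|\<mu>. LINT u:{..<0}|\<mu>. W v u *
             ((- v / (u - v) - \<beta> / (2 * sqrt (real m) * (u - v))) * \<phi> u +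
              (u / (u - v) + \<beta> / (2 * sqrt (real m) * (u - v))) * \<phi> v))"
      using N \<phi> by (simp add: is_mu_m_def c_def W_def)
    also have "(LINT v:{0..}|\<mu>. LINT u:{..<0}|\<mu>. W v u *
             ((- v / (u - v) - \<beta> / (2 * sqrt (real m) * (u - v))) * \<phi> u +
              (u / (u - v) + \<beta> / (2 * sqrt (real m) * (u - v))) * \<phi> v)) = A f"
      unfolding A_def
    proof (subst iterated_integral_eq_pair[where F'="\<lambda>v u. W v u * f (v, u)" and C="exp (\<beta> * K) * C"])
      fix v u :: real assume uv: "0 \<le> v" "v \<le> K" "- K \<le> u" "u < 0"
      have "\<beta> / (2 * sqrt (real m) * (u - v)) = \<kappa> / (u - v)" by (simp add: \<kappa>_def)
      moreover have "(a / d - k / d) * x + (b / d + k / d) * y = ((a - k) * x + (b + k) * y) / d" for a b d k x y :: real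
        by (simp add: add_divide_distrib diff_divide_distrib algebra_simps)
      ultimately have "(- v / (u - v) - \<beta> / (2 * sqrt (real m) * (u - v))) * \<phi> u +
              (u / (u - v) + \<beta> / (2 * sqrt (real m) * (u - v))) * \<phi> v
        = ((- v - \<kappa>) * \<phi> u + (u + \<kappa>) * \<phi> v) / (u - v)"
        by metis
      also have "\<dots> = f (v, u)" using uv eq[OF uv] by simp
      finally show "W v u * ((- v / (u - v) - \<beta> / (2 * sqrt (real m) * (u - v))) * \<phi> u +
              (u / (u - v) + \<beta> / (2 * sqrt (real m) * (u - v))) * \<phi> v) = W v u * f (v, u)" by simp
      show "\<bar>W v u * f (v, u)\<bar> \<le> exp (\<beta> * K) * C" by (intro bound C uv)
    qed simp_all
    finally show ?thesis .
  qed
  have one: "inverse c * A (\<lambda>_. 1) = 1"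
    using int[of "\<lambda>_. 1" "\<lambda>_. 1" 1] N.prob_space by (simp add: algebra_simps)
  have clamp: "continuous_on UNIV (\<lambda>x::real. max (- K) (min K x))"
    "bounded (range (\<lambda>x::real. max (- K) (min K x)))"
    "bounded (range (\<lambda>x::real. (max (- K) (min K x))\<^sup>2))"
  proof -
    show "continuous_on UNIV (\<lambda>x::real. max (- K) (min K x))" by (intro continuous_intros)
    have K': "\<bar>max (- K) (min K x)\<bar> \<le> K" for x :: real using \<open>K > 0\<close> by auto
    then show "bounded (range (\<lambda>x::real. max (- K) (min K x)))" by (auto simp: bounded_iff)
    have "\<bar>(max (- K) (min K x))\<^sup>2\<bar> \<le> K\<^sup>2" for x :: real using power_mono[OF K', of x 2] by simp
    then show "bounded (range (\<lambda>x::real. (max (- K) (min K x))\<^sup>2))" unfolding bounded_iff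
      by (intro exI[of _ "K\<^sup>2"]) auto
  qed
  show supp: "AE x in N. \<bar>x\<bar> \<le> K"
  proof -
    define \<phi> where "\<phi> x = max 0 (min 1 (\<bar>x\<bar> - K))" for x :: real
    have \<phi>: "continuous_on UNIV \<phi>" unfolding \<phi>_def by (intro continuous_intros)
    have [measurable]: "\<phi> \<in> borel_measurable borel" by (rule borel_measurable_continuous_onI[OF \<phi>])
    have "bounded (range \<phi>)" unfolding bounded_iff by (intro exI[of _ 1]) (auto simp: \<phi>_def)
    then have "(LINT x|N. \<phi> x) = inverse c * A (\<lambda>_. 0)"
      by (intro int[of \<phi> "\<lambda>_. 0" 0] \<phi>) (auto simp: \<phi>_def)
    then have "(LINT x|N. \<phi> x) = 0" by (simp add: A_def)
    moreover have "integrable N \<phi>"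
      by (rule N.integrable_const_bound[where B=1]) (auto simp: \<phi>_def)
    ultimately have "AE x in N. \<phi> x = 0"
      by (subst (asm) integral_nonneg_eq_0_iff_AE) (auto simp: \<phi>_def)
    then show ?thesis by eventually_elim (auto simp: \<phi>_def max_def min_def split: if_splits)
  qed
  show "(LINT x|N. x) = - \<beta> / (2 * sqrt (real m))"
  proof -
    have "(LINT x|N. x) = (LINT x|N. max (- K) (min K x))"
      by (rule integral_cong_AE) (use supp in \<open>auto elim!: eventually_mono\<close>)
    also have "\<dots> = inverse c * A (\<lambda>_. 0 - \<kappa> * 1)"
      by (rule int[OF clamp(1,2), of "\<lambda>_. 0 - \<kappa> * 1" "\<bar>\<kappa>\<bar>"]) (auto simp: algebra_simps)
    also have "A (\<lambda>_. 0 - \<kappa> * 1) = A (\<lambda>_. 0) - \<kappa> * A (\<lambda>_. 1)" by (rule A_lin[of "\<lambda>_. 0" "\<lambda>_. 1" 1 \<kappa>]) auto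
    also have "A (\<lambda>_. 0) = 0" by (simp add: A_def)
    finally show ?thesis using one by (simp add: \<kappa>_def algebra_simps)
  qed
  show "(LINT x|N. x\<^sup>2) = sigma2 \<mu> \<beta> - \<beta> / (2 * sqrt (real m)) * (inverse c * A (\<lambda>z. snd z + fst z))"
  proof -
    have "(LINT x|N. x\<^sup>2) = (LINT x|N. (max (- K) (min K x))\<^sup>2)"
      by (rule integral_cong_AE) (use supp in \<open>auto elim!: eventually_mono\<close>)
    also have "\<dots> = inverse c * A (\<lambda>z. - 1 * (snd z * fst z) - \<kappa> * (snd z + fst z))"
    proof (rule int[OF _ clamp(3), of "\<lambda>z. - 1 * (snd z * fst z) - \<kappa> * (snd z + fst z)" "K * K + \<bar>\<kappa>\<bar> * (2 * K)"])
      show "continuous_on UNIV (\<lambda>x. (max (- K) (min K x))\<^sup>2)" by (intro continuous_intros)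
      fix v u assume uv: "0 \<le> v" "v \<le> K" "- K \<le> u" "u < 0"
      then have [simp]: "max (- K) (min K v) = v" "max (- K) (min K u) = u" by auto
      show "(- v - \<kappa>) * (max (- K) (min K u))\<^sup>2 + (u + \<kappa>) * (max (- K) (min K v))\<^sup>2 =
        (u - v) * (- 1 * (snd (v, u) * fst (v, u)) - \<kappa> * (snd (v, u) + fst (v, u)))"
        by (simp add: algebra_simps power2_eq_square)
      have "\<bar>\<kappa> * (u + v)\<bar> \<le> \<bar>\<kappa>\<bar> * (2 * K)" unfolding abs_mult by (intro mult_left_mono uv_bound uv) auto
      then show "\<bar>- 1 * (snd (v, u) * fst (v, u)) - \<kappa> * (snd (v, u) + fst (v, u))\<bar> \<le> K * K + \<bar>\<kappa>\<bar> * (2 * K)"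
        using uv_bound(1)[OF uv] by (simp add: abs_le_iff)
    qed measurable
    also have "A (\<lambda>z. - 1 * (snd z * fst z) - \<kappa> * (snd z + fst z))
        = A (\<lambda>z. - 1 * (snd z * fst z)) - \<kappa> * A (\<lambda>z. snd z + fst z)"
      using uv_bound by (intro A_lin[of "\<lambda>z. - 1 * (snd z * fst z)" "\<lambda>z. snd z + fst z" "max (K * K) (2 * K)" \<kappa>]) (auto simp: le_max_iff_disj)
    also have "A (\<lambda>z. - 1 * (snd z * fst z)) = - A (\<lambda>z. snd z * fst z)"
      unfolding A_def by simp
    finally show ?thesis unfolding sigma2 by (simp add: \<kappa>_def algebra_simps)
  qed
qed

end

section \<open>Convergence of the walks\<close>

lemma converges_in_distribution_offset:
  assumes "converges_in_distribution T (\<lambda>r. M (r + k)) (\<lambda>r. Y (r + k)) P Z"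
  shows "converges_in_distribution T M Y P Z"
proof -
  note * = assms[unfolded converges_in_distribution_def]
  show ?thesis
    unfolding converges_in_distribution_def
  proof (intro conjI allI impI)
    show "\<forall>\<^sub>F m in sequentially. Y m \<in> measurable (M m) (borel_of T)"
      using conjunct1[OF *] eventually_sequentially_seg[of "\<lambda>m. Y m \<in> measurable (M m) (borel_of T)" k]
      by simp
    show "Z \<in> measurable P (borel_of T)" using * by simp
    show "(\<lambda>m. LINT \<omega>|M m. F (Y m \<omega>)) \<longlonglongrightarrow> (LINT \<omega>|P. F (Z \<omega>))"
      if "continuous_map T euclideanreal F \<and> bounded (F ` topspace T)" for F
      using * that by (intro LIMSEQ_offset[of "\<lambda>m. LINT \<omega>|M m. F (Y m \<omega>)" k]) blast
  qed
qed

theorem proposition2p1: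
  fixes \<mu> :: "real measure" and \<beta> :: real
    and N :: "nat \<Rightarrow> real measure"
    and M :: "nat \<Rightarrow> 'a measure" and X :: "nat \<Rightarrow> nat \<Rightarrow> 'a \<Rightarrow> real"
    and P :: "'c measure" and B :: "real \<Rightarrow> 'c \<Rightarrow> real"
    and m0 :: nat
  assumes mu: "real_distribution \<mu>"
    and beta: "\<beta> > 0"
    and mean_neg: "(LINT x|\<mu>. x) < 0"
    and exp_moment: "(LINT x|\<mu>. exp (\<beta> * x)) = 1"
    and compact_support: "compact (measure_support \<mu>)"
    \<comment> \<open>The defining formula of the measure \<open>N m\<close> can give negative mass for small \<open>m\<close>; hence a general
       starting index \<open>m0\<close>, with \<open>m0 = 1\<close> as a special case.\<close>
    and start: "m0 \<ge> 1"
    and mu_m: "\<And>m. m \<ge> m0 \<Longrightarrow> is_mu_m \<mu> \<beta> m (N m)"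
    and prob: "\<And>m. m \<ge> m0 \<Longrightarrow> prob_space (M m)"
    and indep: "\<And>m. m \<ge> m0 \<Longrightarrow> prob_space.indep_vars (M m) (\<lambda>_. borel) (X m) {1..}"
    and law: "\<And>m i. m \<ge> m0 \<Longrightarrow> i \<ge> 1 \<Longrightarrow> distr (M m) borel (X m i) = N m"
    and brownian: "standard_brownian_motion P B"
  shows "converges_in_distribution skorokhod
           M (\<lambda>m \<omega>. \<lambda>t\<in>{0..}. (1 / sqrt (real m)) * (\<Sum>i=1..nat \<lfloor>real m * t\<rfloor>. X m i \<omega>))
           P (\<lambda>\<omega>. \<lambda>t\<in>{0..}. sqrt (sigma2 \<mu> \<beta>) * B t \<omega> - \<beta> / 2 * t)"
proof -
  have "sets \<mu> = sets borel" using mu by (simp add: real_distribution_def real_distribution_axioms_def)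
  then obtain K where K: "K > 0" "AE x in \<mu>. \<bar>x\<bar> \<le> K"
    using AE_bounded_of_compact_support compact_support by metis
  obtain D where bdd: "\<And>m N. is_mu_m \<mu> \<beta> m N \<Longrightarrow> AE x in N. \<bar>x\<bar> \<le> K"
    and mean: "\<And>m N. is_mu_m \<mu> \<beta> m N \<Longrightarrow> (LINT x|N. x) = - \<beta> / (2 * sqrt (real m))"
    and var: "\<And>m N. is_mu_m \<mu> \<beta> m N \<Longrightarrow> (LINT x|N. x\<^sup>2) = sigma2 \<mu> \<beta> - \<beta> / (2 * sqrt (real m)) * D"
    using is_mu_m_moments[OF mu K(2,1) beta] by metis
  define n where "n r = r + m0" for r
  have n: "filterlim n at_top sequentially"
    unfolding n_def by (rule filterlim_add_const_nat_at_top)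
  have n_ge: "n r \<ge> m0" "n r \<ge> 1" for r using start by (auto simp: n_def)
  \<comment> \<open>Nonnegativity of the variance comes from its being a limit of second moments.\<close>
  have var_lim: "(\<lambda>r. LINT x|N (n r). x\<^sup>2) \<longlonglongrightarrow> sigma2 \<mu> \<beta>"
  proof -
    have "(\<lambda>r. \<beta> / 2 * D / sqrt (real (n r))) \<longlonglongrightarrow> 0"
      by (intro tendsto_divide_0[OF tendsto_const] filterlim_at_top_imp_at_infinity
          filterlim_compose[OF sqrt_at_top] filterlim_compose[OF filterlim_real_sequentially] n)
    from tendsto_diff[OF tendsto_const this, of "sigma2 \<mu> \<beta>"] show ?thesis
      by (simp add: var[OF mu_m[OF n_ge(1)]] mult.commute)
  qed
  have "sigma2 \<mu> \<beta> \<ge> 0" by (rule tendsto_lowerbound[OF var_lim]) auto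
  then have sigma: "sigma2 \<mu> \<beta> = (sqrt (sigma2 \<mu> \<beta>))\<^sup>2" by simp
  have "converges_in_distribution skorokhod (\<lambda>r. M (n r)) (\<lambda>r \<omega>. rescaled_walk (n r) (\<lambda>i. X (n r) i \<omega>))
     P (\<lambda>\<omega>. \<lambda>t\<in>{0..}. sqrt (sigma2 \<mu> \<beta>) * B t \<omega> + (- \<beta> / 2) * t)"
  proof (rule walk_converges_to_brownian_motion_with_drift[where \<nu>="\<lambda>r. N (n r)" and K=K])
    show "real_distribution (N (n r))" for r using mu_m[OF n_ge(1)] by (simp add: is_mu_m_def)
    show "AE x in N (n r). \<bar>x\<bar> \<le> K" for r by (rule bdd[OF mu_m[OF n_ge(1)]])
    have "sqrt (real (n r)) * (LINT x|N (n r). x) = - \<beta> / 2" for r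
      using n_ge(2)[of r] by (simp add: mean[OF mu_m[OF n_ge(1)]])
    then show "(\<lambda>r. sqrt (real (n r)) * (LINT x|N (n r). x)) \<longlonglongrightarrow> - \<beta> / 2" by simp
    show "(\<lambda>r. LINT x|N (n r). x\<^sup>2) \<longlonglongrightarrow> (sqrt (sigma2 \<mu> \<beta>))\<^sup>2"
      using var_lim sigma by simp
  qed (use K n prob indep law brownian n_ge in auto)
  then have conv: "converges_in_distribution skorokhod (\<lambda>r. M (r + m0))
      (\<lambda>r \<omega>. rescaled_walk (r + m0) (\<lambda>i. X (r + m0) i \<omega>))
      P (\<lambda>\<omega>. \<lambda>t\<in>{0..}. sqrt (sigma2 \<mu> \<beta>) * B t \<omega> - \<beta> / 2 * t)"
    by (simp add: n_def)
  have "converges_in_distribution skorokhod M (\<lambda>m \<omega>. rescaled_walk m (\<lambda>i. X m i \<omega>))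
      P (\<lambda>\<omega>. \<lambda>t\<in>{0..}. sqrt (sigma2 \<mu> \<beta>) * B t \<omega> - \<beta> / 2 * t)"
    by (rule converges_in_distribution_offset[OF conv])
  then show ?thesis by (simp only: rescaled_walk_def)
qed

end
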